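(* Let $\phi,\psi$ be meromorphic functions on $\mathbb P$. Then 1. if $D\subset\mathbb P$ is a disc and $\phi,\psi$ are regular along $\partial D$, then ${}_D\Phi\circ{}_D\Psi-{}_D\Psi\circ{}_D\Phi=-\frac{1}{2\pi i}\int_{\partial D}\phi\,d\psi$; 2. for $P\in\mathbb P$, $\Phi_P\circ\Psi_P-\Psi_P\circ\Phi_P=\mathrm{Res}_P(\phi\,d\psi)$; 3. for $O\in\mathbb P$, ${}_O\Phi\circ{}_O\Psi-{}_O\Psi\circ{}_O\Phi=-\mathrm{Res}_O(\phi\,d\psi)$. (The right sides act as scalars.)
   Context: $\mathbb P$ is a complex projective line. $\mathbf K$ is the space of meromorphic 1-forms on $\mathbb P$ with all residues zero, $\mathbf W=S^*\mathbf K$ its symmetric algebra (product $\otimes^s$). A disc $D\subset\mathbb P$ is an open simply connected domain, biholomorphic to a disc, with smooth boundary $\partial D$ oriented counterclockwise around $D$; $D'$ is the complement of its closure. $\mathbf W_{\partial D}$ is the symmetric algebra over the space of forms in $\mathbf K$ regular along $\partial D$. The following operators depend linearly on the function $\phi$; every meromorphic function (in the first case: regular along $\partial D$) is a sum of functions of the two listed types, unique up to constants, and constants act by zero. (a) For $\phi$ regular along $\partial D$, ${}_D\Phi:\mathbf W_{\partial D}\to\mathbf W_{\partial D}$ is $${}_D\Phi[\alpha_1\otimes^s\cdots\otimes^s\alpha_p]=-\sum_i(\alpha_1\otimes^s\cdots\widehat{\alpha_i}\cdots\otimes^s\alpha_p)\,\frac1{2\pi i}\int_{\partial D}\phi\alpha_i+\delta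 ,$$ with $\delta=d\phi\otimes^s\alpha_1\otimes^s\cdots\otimes^s\alpha_p$ if $\phi$ is regular in $D'$, and $\delta=0$ if $\phi$ is regular in $D$. (b) For $\phi$ meromorphic, $\Phi_P:\mathbf W\to\mathbf W$ is $$\Phi_P[\alpha_1\otimes^s\cdots\otimes^s\alpha_p]=\sum_i(\alpha_1\otimes^s\cdots\widehat{\alpha_i}\cdots\otimes^s\alpha_p)\,\mathrm{Res}_P(\phi\alpha_i)+\delta ,$$ with $\delta=d\phi\otimes^s\alpha_1\otimes^s\cdots\otimes^s\alpha_p$ if $\phi$ is regular at $P$, and $\delta=0$ if $\phi$ is regular away from $P$. (c) For $\phi$ meromorphic, ${}_O\Phi:\mathbf W\to\mathbf W$ is $${}_O\Phi[\alpha_1\otimes^s\cdots\otimes^s\alpha_p]=-\sum_i(\alpha_1\otimes^s\cdots\widehat{\alpha_i}\cdots\otimes^s\alpha_p)\,\mathrm{Res}_O(\phi\alpha_i)+\delta ,$$ with $\delta=d\phi\otimes^s\alpha_1\otimes^s\cdots\otimes^s\alpha_p$ if $\phi$ is regular away from $O$, and $\delta=0$ if $\phi$ is regular at $O$. A hat marks an omitted factor. $\Psi$ denotes the analogous operators built from $\psi$. *)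

theory Defs
  imports
    "HOL-Complex_Analysis.Complex_Analysis"
    "HOL-Algebra.QuotRing"
    "HOL-Library.Poly_Mapping"
begin

section \<open>The complex projective line\<close>

datatype proj_line = Fin complex | Infty

text \<open>The two standard charts \<open>z \<mapsto> [z : 1]\<close> (this is \<^const>\<open>Fin\<close>) and \<open>w \<mapsto> [1 : w]\<close>,
  glued along \<open>w = 1 / z\<close>.  The coordinate functions \<open>coord0\<close> and \<open>coord_inf\<close> invert them;
  their values at \<^const>\<open>Infty\<close> and at \<open>Fin 0\<close> respectively are junk.\<close>

definition chart_inf :: "complex \<Rightarrow> proj_line" where
  "chart_inf w = (if w = 0 then Infty else Fin (1 / w))"

definition coord0 :: "proj_line \<Rightarrow> complex" where
  "coord0 P = (case P of Fin z \<Rightarrow> z | Infty \<Rightarrow> 0)"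

definition coord_inf :: "proj_line \<Rightarrow> complex" where
  "coord_inf P = (case P of Fin z \<Rightarrow> 1 / z | Infty \<Rightarrow> 0)"

instantiation proj_line :: topological_space
begin

definition open_proj_line :: "proj_line set \<Rightarrow> bool" where
  "open_proj_line U \<longleftrightarrow> open (Fin -` U) \<and> open (chart_inf -` U)"

instance
  by standard (auto simp: open_proj_line_def vimage_Union)

end


section \<open>Meromorphic functions and 1-forms\<close>

lemma remove_sings_add_right:
  assumes "f meromorphic_on UNIV" "g meromorphic_on UNIV"
  shows "remove_sings (\<lambda>z. f z + remove_sings g z) = remove_sings (\<lambda>z. f z + g z)"
proof (rule ext, rule remove_sings_cong)
  fix z
  have "\<forall>\<^sub>F w in at z. remove_sings g w = g w"
    using assms(2) meromorphic_at_iff meromorphic_on_subset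
    by (blast intro: eventually_remove_sings_eq_at)
  then show "\<forall>\<^sub>F w in at z. f w + remove_sings g w = f w + g w"
    by eventually_elim auto
qed auto

lemma remove_sings_add_left:
  assumes "f meromorphic_on UNIV" "g meromorphic_on UNIV"
  shows "remove_sings (\<lambda>z. remove_sings f z + g z) = remove_sings (\<lambda>z. f z + g z)"
  using remove_sings_add_right[OF assms(2,1)] by (simp add: add.commute)

lemma remove_sings_add_assoc:
  assumes "f meromorphic_on UNIV" "g meromorphic_on UNIV" "h meromorphic_on UNIV"
  shows "remove_sings (\<lambda>z. remove_sings (\<lambda>z. f z + g z) z + h z) =
         remove_sings (\<lambda>z. f z + remove_sings (\<lambda>z. g z + h z) z)"
proof -
  have "(\<lambda>z. f z + g z) meromorphic_on UNIV" "(\<lambda>z. g z + h z) meromorphic_on UNIV"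
    by (intro meromorphic_on_add assms)+
  then show ?thesis
    using assms by (simp only: remove_sings_add_left remove_sings_add_right add.assoc)
qed

lemma remove_sings_nicely_id:
  assumes "f nicely_meromorphic_on UNIV"
  shows "remove_sings f = f"
proof
  fix z
  have "(is_pole f z \<and> f z = 0) \<or> f \<midarrow>z\<rightarrow> f z"
    using assms by (auto simp: nicely_meromorphic_on_def)
  then show "remove_sings f z = f z"
    by auto
qed

lemma nicely_imp_meromorphic: "f nicely_meromorphic_on S \<Longrightarrow> f meromorphic_on S"
  by (simp add: nicely_meromorphic_on_def)

lemma remove_sings_nicely_UNIV:
  assumes "f meromorphic_on UNIV"
  shows "remove_sings f nicely_meromorphic_on UNIV"
  using assms by (rule remove_sings_nicely_meromorphic)

lemma eventually_remove_sings_inverse: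
  assumes "(\<lambda>w. f (1 / w)) meromorphic_on {0}"
  shows "\<forall>\<^sub>F w in at 0. f analytic_on {1 / w}"
proof -
  have "isolated_singularity_at (\<lambda>w. f (1 / w)) 0"
    using assms by (simp add: meromorphic_at_iff)
  then obtain r where r: "r > 0" "(\<lambda>w. f (1 / w)) analytic_on ball 0 r - {0}"
    by (auto simp: isolated_singularity_at_def)
  have *: "f analytic_on {1 / w}" if "w \<in> ball 0 r - {0}" for w
  proof -
    have "(\<lambda>w. f (1 / w)) analytic_on {w}"
      using r(2) by (rule analytic_on_subset) (use that in auto)
    moreover have "(\<lambda>z. 1 / z) analytic_on {1 / w}"
      using that by (auto intro!: analytic_intros)
    ultimately have "((\<lambda>w. f (1 / w)) \<circ> (\<lambda>z. 1 / z)) analytic_on {1 / w}"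
      using that by (intro analytic_on_compose_gen[where T = "{w}"]) auto
    then show ?thesis by (simp add: o_def)
  qed
  have "\<forall>\<^sub>F w in at 0. w \<in> ball 0 r - {0}"
    using r(1) by (intro eventually_at_in_open) auto
  then show ?thesis
    by eventually_elim (rule *)
qed

lemma remove_sings_inverse_meromorphic:
  assumes "(\<lambda>w. f (1 / w)) meromorphic_on {0}"
  shows "(\<lambda>w. remove_sings f (1 / w)) meromorphic_on {0}"
proof -
  have "\<forall>\<^sub>F w in at 0. f (1 / w) = remove_sings f (1 / w)"
    using eventually_remove_sings_inverse[OF assms] by eventually_elim auto
  then show ?thesis
    using assms by (subst meromorphic_on_cong[where g = "\<lambda>w. f (1 / w)" and B = "{0}"])
      (auto elim: eventually_mono)
qed

lemma remove_sings_cmult: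
  assumes "f meromorphic_on UNIV"
  shows "remove_sings (\<lambda>z. c * f z) = (\<lambda>z. c * remove_sings f z)"
proof -
  have "remove_sings (\<lambda>z. c * f z) = remove_sings (\<lambda>z. c * remove_sings f z)"
  proof (rule ext, rule remove_sings_cong)
    fix z
    have "\<forall>\<^sub>F w in at z. remove_sings f w = f w"
      using assms meromorphic_at_iff meromorphic_on_subset
      by (blast intro: eventually_remove_sings_eq_at)
    then show "\<forall>\<^sub>F w in at z. c * f w = c * remove_sings f w"
      by eventually_elim auto
  qed auto
  also have "\<dots> = (\<lambda>z. c * remove_sings f z)"
    by (intro remove_sings_nicely_id nicely_meromorphic_on_cmult_left remove_sings_nicely_UNIV assms)
  finally show ?thesis .
qed

text \<open>The chart at infinity puts a factor \<open>- 1 / w\<^sup>2\<close> (from \<open>d(1 / w)\<close>) on the coefficient of a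
  form, which is irrelevant for meromorphy.\<close>

lemma form_at_infinity_iff:
  "(\<lambda>w. - f (1 / w) / w\<^sup>2) meromorphic_on {0} \<longleftrightarrow> (\<lambda>w. f (1 / w)) meromorphic_on {0}"
proof
  assume "(\<lambda>w. - f (1 / w) / w\<^sup>2) meromorphic_on {0}"
  then have "(\<lambda>w. (- f (1 / w) / w\<^sup>2) * - (w\<^sup>2)) meromorphic_on {0}"
    by (rule meromorphic_on_mult) (intro meromorphic_intros)
  moreover have "\<forall>\<^sub>F w::complex in at 0. w \<noteq> 0"
    by (simp add: eventually_at_filter)
  then have "\<forall>\<^sub>F w in at 0. (- f (1 / w) / w\<^sup>2) * - (w\<^sup>2) = f (1 / w)"
    by eventually_elim auto
  then have "(\<lambda>w. (- f (1 / w) / w\<^sup>2) * - (w\<^sup>2)) meromorphic_on {0} \<longleftrightarrow>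
      (\<lambda>w. f (1 / w)) meromorphic_on {0}"
    by (intro meromorphic_on_cong) auto
  ultimately show "(\<lambda>w. f (1 / w)) meromorphic_on {0}"
    by blast
next
  assume "(\<lambda>w. f (1 / w)) meromorphic_on {0}"
  then show "(\<lambda>w. - f (1 / w) / w\<^sup>2) meromorphic_on {0}"
    by (intro meromorphic_intros)
qed

text \<open>A meromorphic function on the projective line is represented by its expression in the
  affine coordinate \<open>z\<close>, normalised to be continuous away from its poles and \<open>0\<close> at its poles.\<close>

typedef mfun = "{f. f nicely_meromorphic_on UNIV \<and> (\<lambda>w. f (1 / w)) meromorphic_on {0}}"
  morphisms mf_val Abs_mfun
  by (rule exI[of _ "\<lambda>_. 0"]) auto

text \<open>A meromorphic 1-form \<open>f(z) dz = - f(1 / w) / w\<^sup>2 dw\<close> is represented by its coefficient \<open>f\<close>.\<close>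

typedef mform = "{f. f nicely_meromorphic_on UNIV \<and> (\<lambda>w. - f (1 / w) / w\<^sup>2) meromorphic_on {0}}"
  morphisms coeff Abs_mform
  by (rule exI[of _ "\<lambda>_. 0"]) auto

definition coeff_inf :: "mform \<Rightarrow> complex \<Rightarrow> complex" where
  "coeff_inf \<alpha> = remove_sings (\<lambda>w. - coeff \<alpha> (1 / w) / w\<^sup>2)"

setup_lifting type_definition_mfun
setup_lifting type_definition_mform

instantiation mfun :: ab_group_add
begin

lift_definition zero_mfun :: mfun is "\<lambda>_. 0"
  by auto

lift_definition plus_mfun :: "mfun \<Rightarrow> mfun \<Rightarrow> mfun" is "\<lambda>f g. remove_sings (\<lambda>z. f z + g z)"
  by (auto intro!: remove_sings_nicely_UNIV remove_sings_inverse_meromorphic meromorphic_intros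
      dest: nicely_imp_meromorphic)

lift_definition uminus_mfun :: "mfun \<Rightarrow> mfun" is "\<lambda>f z. - f z"
  by (auto intro!: meromorphic_intros)

definition minus_mfun :: "mfun \<Rightarrow> mfun \<Rightarrow> mfun" where
  "minus_mfun f g = f + - g"

instance
proof
  fix a b c :: mfun
  show "a + b + c = a + (b + c)"
    by transfer (blast intro: remove_sings_add_assoc nicely_imp_meromorphic)
  show "a + b = b + a"
    by transfer (simp add: add.commute)
  show "0 + a = a"
    by transfer (simp add: remove_sings_nicely_id)
  show "- a + a = 0"
    by transfer auto
  show "a - b = a + - b"
    by (simp add: minus_mfun_def)
qed

end

instantiation mform :: ab_group_add
begin

lift_definition zero_mform :: mform is "\<lambda>_. 0"
  by auto

lift_definition plus_mform :: "mform \<Rightarrow> mform \<Rightarrow> mform" is "\<lambda>f g. remove_sings (\<lambda>z. f z + g z)"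
  unfolding form_at_infinity_iff
  by (auto intro!: remove_sings_nicely_UNIV remove_sings_inverse_meromorphic meromorphic_intros
      dest: nicely_imp_meromorphic)

lift_definition uminus_mform :: "mform \<Rightarrow> mform" is "\<lambda>f z. - f z"
  unfolding form_at_infinity_iff by (auto intro!: meromorphic_intros)

definition minus_mform :: "mform \<Rightarrow> mform \<Rightarrow> mform" where
  "minus_mform f g = f + - g"

instance
proof
  fix a b c :: mform
  show "a + b + c = a + (b + c)"
    by transfer (blast intro: remove_sings_add_assoc nicely_imp_meromorphic)
  show "a + b = b + a"
    by transfer (simp add: add.commute)
  show "0 + a = a"
    by transfer (simp add: remove_sings_nicely_id)
  show "- a + a = 0"
    by transfer auto
  show "a - b = a + - b"
    by (simp add: minus_mform_def)
qed

end

lift_definition mform_scale :: "complex \<Rightarrow> mform \<Rightarrow> mform" is "\<lambda>c f z. c * f z"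
  unfolding form_at_infinity_iff by (auto intro!: meromorphic_intros)

interpretation mform: vector_space mform_scale
proof
  fix a b :: complex and x y :: mform
  show "mform_scale a (x + y) = mform_scale a x + mform_scale a y"
  proof (transfer, clarify)
    fix a and f g :: "complex \<Rightarrow> complex"
    assume "f nicely_meromorphic_on UNIV" "g nicely_meromorphic_on UNIV"
    then have "(\<lambda>z. f z + g z) meromorphic_on UNIV"
      by (intro meromorphic_on_add nicely_imp_meromorphic)
    from remove_sings_cmult[OF this, of a]
    show "(\<lambda>z. a * remove_sings (\<lambda>z. f z + g z) z) = remove_sings (\<lambda>z. a * f z + a * g z)"
      by (simp add: distrib_left)
  qed
  show "mform_scale (a + b) x = mform_scale a x + mform_scale b x"
  proof (transfer, clarify)
    fix a b and f :: "complex \<Rightarrow> complex" assume "f nicely_meromorphic_on UNIV"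
    then have "remove_sings (\<lambda>z. (a + b) * f z) = (\<lambda>z. (a + b) * f z)"
      by (intro remove_sings_nicely_id) auto
    then show "(\<lambda>z. (a + b) * f z) = remove_sings (\<lambda>z. a * f z + b * f z)"
      by (simp add: distrib_right)
  qed
  show "mform_scale a (mform_scale b x) = mform_scale (a * b) x"
    by transfer (simp add: mult.assoc)
  show "mform_scale 1 x = x"
    by transfer simp
qed

lift_definition fun_times_form :: "mfun \<Rightarrow> mform \<Rightarrow> mform" (infixr \<open>\<cdot>\<close> 75)
  is "\<lambda>f g. remove_sings (\<lambda>z. f z * g z)"
  unfolding form_at_infinity_iff
  by (auto intro!: remove_sings_nicely_UNIV remove_sings_inverse_meromorphic meromorphic_intros
      dest: nicely_imp_meromorphic)

lift_definition differential :: "mfun \<Rightarrow> mform" is "\<lambda>f. remove_sings (deriv f)"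
proof -
  fix f :: "complex \<Rightarrow> complex"
  assume "f nicely_meromorphic_on UNIV \<and> (\<lambda>w. f (1 / w)) meromorphic_on {0}"
  then have f: "f meromorphic_on UNIV" "(\<lambda>w. f (1 / w)) meromorphic_on {0}"
    by (auto simp: nicely_meromorphic_on_def)
  have "\<forall>\<^sub>F w::complex in at 0. w \<noteq> 0"
    by (simp add: eventually_at_filter)
  with eventually_remove_sings_inverse[OF f(2)]
  have "\<forall>\<^sub>F w in at 0. deriv (\<lambda>w. f (1 / w)) w = - deriv f (1 / w) / w\<^sup>2"
  proof eventually_elim
    case (elim w)
    then have "(f has_field_derivative deriv f (1 / w)) (at (1 / w))"
      by (simp add: analytic_on_imp_differentiable_at DERIV_deriv_iff_field_differentiable)
    from DERIV_chain2[where g = "\<lambda>w. 1 / w" and x = w, OF this] elim(2)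
    have "((\<lambda>w. f (1 / w)) has_field_derivative deriv f (1 / w) * (- 1 / w\<^sup>2)) (at w)"
      by (force intro: derivative_eq_intros simp: power2_eq_square)
    then show ?case
      by (simp add: DERIV_imp_deriv)
  qed
  moreover have "deriv (\<lambda>w. f (1 / w)) meromorphic_on {0}"
    using f(2) by (rule meromorphic_on_deriv)
  ultimately have "(\<lambda>w. - deriv f (1 / w) / w\<^sup>2) meromorphic_on {0}"
    by (subst meromorphic_on_cong[where g = "deriv (\<lambda>w. f (1 / w))" and B = "{0}"])
      (auto elim: eventually_mono)
  then show "remove_sings (deriv f) nicely_meromorphic_on UNIV \<and>
      (\<lambda>w. - remove_sings (deriv f) (1 / w) / w\<^sup>2) meromorphic_on {0}"
    unfolding form_at_infinity_iff using f(1)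
    by (auto intro!: remove_sings_nicely_UNIV remove_sings_inverse_meromorphic meromorphic_intros)
qed

definition fun_regular_on :: "proj_line set \<Rightarrow> mfun \<Rightarrow> bool" where
  "fun_regular_on S f \<longleftrightarrow>
     (\<forall>P\<in>S. case P of Fin z \<Rightarrow> \<not> is_pole (mf_val f) z
                    | Infty \<Rightarrow> \<not> is_pole (\<lambda>w. mf_val f (1 / w)) 0)"

definition form_regular_on :: "proj_line set \<Rightarrow> mform \<Rightarrow> bool" where
  "form_regular_on S \<alpha> \<longleftrightarrow>
     (\<forall>P\<in>S. case P of Fin z \<Rightarrow> \<not> is_pole (coeff \<alpha>) z
                    | Infty \<Rightarrow> \<not> is_pole (coeff_inf \<alpha>) 0)"

definition Res :: "proj_line \<Rightarrow> mform \<Rightarrow> complex" where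
  "Res P \<alpha> = (case P of Fin z \<Rightarrow> residue (coeff \<alpha>) z | Infty \<Rightarrow> residue (coeff_inf \<alpha>) 0)"

definition K_space :: "mform set" where
  "K_space = {\<alpha>. \<forall>P. Res P \<alpha> = 0}"


section \<open>Discs and their boundaries\<close>

definition holo_from_proj :: "proj_line set \<Rightarrow> (proj_line \<Rightarrow> complex) \<Rightarrow> bool" where
  "holo_from_proj D g \<longleftrightarrow>
     (\<lambda>z. g (Fin z)) holomorphic_on (Fin -` D) \<and>
     (\<lambda>w. g (chart_inf w)) holomorphic_on (chart_inf -` D)"

definition holo_to_proj :: "complex set \<Rightarrow> (complex \<Rightarrow> proj_line) \<Rightarrow> bool" where
  "holo_to_proj S h \<longleftrightarrow> continuous_on S h \<and>
     (\<lambda>z. coord0 (h z)) holomorphic_on {z \<in> S. h z \<noteq> Infty} \<and>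
     (\<lambda>z. coord_inf (h z)) holomorphic_on {z \<in> S. h z \<noteq> Fin 0}"

definition biholomorphic_to_disc :: "proj_line set \<Rightarrow> bool" where
  "biholomorphic_to_disc D \<longleftrightarrow>
     (\<exists>g h. holo_from_proj D g \<and> holo_to_proj (ball 0 1) h \<and>
            g ` D = ball 0 1 \<and> h ` ball 0 1 = D \<and>
            (\<forall>P\<in>D. h (g P) = P) \<and> (\<forall>z\<in>ball 0 1. g (h z) = z))"

text \<open>Infinitely differentiable on the open set \<open>T\<close>; \<open>G n\<close> is the \<open>n\<close>-th derivative.\<close>

definition smooth_on :: "real set \<Rightarrow> (real \<Rightarrow> complex) \<Rightarrow> bool" where
  "smooth_on T c \<longleftrightarrow>
     (\<exists>G. (\<forall>t\<in>T. G (0::nat) t = c t) \<and>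
          (\<forall>n. \<forall>t\<in>T. (G n has_vector_derivative G (Suc n) t) (at t)))"

definition smooth_curve :: "(real \<Rightarrow> proj_line) \<Rightarrow> bool" where
  "smooth_curve \<gamma> \<longleftrightarrow> continuous_on UNIV \<gamma> \<and>
     smooth_on {t. \<gamma> t \<noteq> Infty} (\<lambda>t. coord0 (\<gamma> t)) \<and>
     smooth_on {t. \<gamma> t \<noteq> Fin 0} (\<lambda>t. coord_inf (\<gamma> t))"

text \<open>\<open>\<gamma>\<close> is a 1-periodic regular smooth parametrisation of the boundary of \<open>D\<close>, simple on a period,
  and counterclockwise around \<open>D\<close>: the left normal \<open>\<i> \<gamma>'(t)\<close> points into \<open>D\<close>.  The condition is
  stated in each chart; as the transition map is holomorphic, the two versions agree where both
  apply.\<close>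

definition boundary_param :: "proj_line set \<Rightarrow> (real \<Rightarrow> proj_line) \<Rightarrow> bool" where
  "boundary_param D \<gamma> \<longleftrightarrow>
     smooth_curve \<gamma> \<and> (\<forall>t. \<gamma> (t + 1) = \<gamma> t) \<and> inj_on \<gamma> {0..<1} \<and> range \<gamma> = frontier D \<and>
     (\<forall>t. \<gamma> t \<noteq> Infty \<longrightarrow>
        (let v = vector_derivative (\<lambda>t. coord0 (\<gamma> t)) (at t)
         in v \<noteq> 0 \<and>
            (\<forall>\<^sub>F \<epsilon> in at_right 0. Fin (coord0 (\<gamma> t) + of_real \<epsilon> * \<i> * v) \<in> D))) \<and>
     (\<forall>t. \<gamma> t \<noteq> Fin 0 \<longrightarrow>
        (let v = vector_derivative (\<lambda>t. coord_inf (\<gamma> t)) (at t)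
         in v \<noteq> 0 \<and>
            (\<forall>\<^sub>F \<epsilon> in at_right 0. chart_inf (coord_inf (\<gamma> t) + of_real \<epsilon> * \<i> * v) \<in> D)))"

definition is_disc :: "proj_line set \<Rightarrow> bool" where
  "is_disc D \<longleftrightarrow> open D \<and> connected D \<and> simply_connected D \<and> biholomorphic_to_disc D \<and>
     (\<exists>\<gamma>. boundary_param D \<gamma>)"

definition exterior :: "proj_line set \<Rightarrow> proj_line set" where
  "exterior D = - closure D"

text \<open>The coefficient of \<open>dt\<close> in the pullback of \<open>\<alpha>\<close>; the curve may pass through infinity.\<close>

definition pullback :: "(real \<Rightarrow> proj_line) \<Rightarrow> mform \<Rightarrow> real \<Rightarrow> complex" where
  "pullback \<gamma> \<alpha> t =
     (if \<gamma> t = Infty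
      then coeff_inf \<alpha> 0 * vector_derivative (\<lambda>t. coord_inf (\<gamma> t)) (at t)
      else coeff \<alpha> (coord0 (\<gamma> t)) * vector_derivative (\<lambda>t. coord0 (\<gamma> t)) (at t))"

text \<open>The integral does not depend on the parametrisation chosen.\<close>

definition boundary_integral :: "proj_line set \<Rightarrow> mform \<Rightarrow> complex" where
  "boundary_integral D \<alpha> = integral {0..1} (pullback (SOME \<gamma>. boundary_param D \<gamma>) \<alpha>)"


section \<open>The symmetric algebra over a space of forms\<close>

text \<open>\<open>Sym V\<close>, for a linear subspace \<open>V\<close>, is the commutative polynomial algebra with one variable
  for each element of \<open>V\<close>, modulo the ideal generated by the linear relations between the
  elements of \<open>V\<close>.  Monomials are multisets of elements of \<open>V\<close>, so that the class of the monomial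
  \<open>{#\<alpha>\<^sub>1, \<dots>, \<alpha>\<^sub>p#}\<close> is the product \<open>\<alpha>\<^sub>1 \<otimes>\<^sup>s \<dots> \<otimes>\<^sup>s \<alpha>\<^sub>p\<close>.\<close>

type_synonym sym_poly = "mform multiset \<Rightarrow>\<^sub>0 complex"

definition free_alg :: "mform set \<Rightarrow> sym_poly ring" where
  "free_alg V =
     \<lparr>carrier = {p. \<forall>m\<in>Poly_Mapping.keys p. set_mset m \<subseteq> V}, monoid.mult = (*), one = 1,
      ring.zero = 0, add = (+)\<rparr>"

abbreviation var :: "mform \<Rightarrow> sym_poly" where
  "var \<alpha> \<equiv> Poly_Mapping.single {#\<alpha>#} 1"

abbreviation const :: "complex \<Rightarrow> sym_poly" where
  "const c \<equiv> Poly_Mapping.single {#} c"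

definition linear_relations :: "mform set \<Rightarrow> sym_poly set" where
  "linear_relations V =
     {var (\<alpha> + \<beta>) - (var \<alpha> + var \<beta>) | \<alpha> \<beta>. \<alpha> \<in> V \<and> \<beta> \<in> V} \<union>
     {var (mform_scale c \<alpha>) - const c * var \<alpha> | c \<alpha>. \<alpha> \<in> V}"

definition sym_ideal :: "mform set \<Rightarrow> sym_poly set" where
  "sym_ideal V = genideal (free_alg V) (linear_relations V)"

definition Sym :: "mform set \<Rightarrow> sym_poly set ring" where
  "Sym V = free_alg V Quot sym_ideal V"

definition sym_class :: "mform set \<Rightarrow> sym_poly \<Rightarrow> sym_poly set" where
  "sym_class V p = sym_ideal V +>\<^bsub>free_alg V\<^esub> p"

definition sym_prod :: "mform set \<Rightarrow> mform list \<Rightarrow> sym_poly set" where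
  "sym_prod V \<alpha>s = sym_class V (Poly_Mapping.single (mset \<alpha>s) 1)"

definition sym_scale :: "mform set \<Rightarrow> complex \<Rightarrow> sym_poly set \<Rightarrow> sym_poly set" where
  "sym_scale V c w = sym_class V (const c) \<otimes>\<^bsub>Sym V\<^esub> w"

text \<open>For a linear functional \<open>A\<close> on \<open>V\<close>, \<open>annihilate V A\<close> is the linear operator on \<open>Sym V\<close> with
  \<open>\<alpha>\<^sub>1 \<otimes>\<^sup>s \<dots> \<otimes>\<^sup>s \<alpha>\<^sub>p \<mapsto> \<Sum>\<^sub>i A(\<alpha>\<^sub>i) \<alpha>\<^sub>1 \<otimes>\<^sup>s \<dots> (omit \<alpha>\<^sub>i) \<dots> \<otimes>\<^sup>s \<alpha>\<^sub>p\<close>: the operator given by this formula on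
  polynomials, passed to classes.\<close>

definition annihilate_poly :: "(mform \<Rightarrow> complex) \<Rightarrow> sym_poly \<Rightarrow> sym_poly" where
  "annihilate_poly A p =
     (\<Sum>m\<in>Poly_Mapping.keys p. \<Sum>\<alpha>\<in>#m. Poly_Mapping.single (m - {#\<alpha>#}) (Poly_Mapping.lookup p m * A \<alpha>))"

definition annihilate :: "mform set \<Rightarrow> (mform \<Rightarrow> complex) \<Rightarrow> sym_poly set \<Rightarrow> sym_poly set" where
  "annihilate V A w = (\<Union>p\<in>w. sym_class V (annihilate_poly A p))"

lemma annihilate_poly_superset:
  assumes "finite S" "Poly_Mapping.keys p \<subseteq> S"
  shows "annihilate_poly A p =
    (\<Sum>m\<in>S. \<Sum>\<alpha>\<in>#m. Poly_Mapping.single (m - {#\<alpha>#}) (Poly_Mapping.lookup p m * A \<alpha>))"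
  unfolding annihilate_poly_def
  by (rule sum.mono_neutral_left) (use assms in \<open>auto simp: in_keys_iff intro!: sum_mset.neutral\<close>)

lemma annihilate_poly_add: "annihilate_poly A (p + q) = annihilate_poly A p + annihilate_poly A q"
proof -
  let ?S = "Poly_Mapping.keys p \<union> Poly_Mapping.keys q"
  have "Poly_Mapping.keys (p + q) \<subseteq> ?S" by (rule keys_add)
  then show ?thesis
    by (simp add: annihilate_poly_superset[of ?S] lookup_add distrib_right single_add
        sum_mset.distrib sum.distrib)
qed

lemma annihilate_poly_0 [simp]: "annihilate_poly A 0 = 0"
  by (simp add: annihilate_poly_def)

lemma annihilate_poly_uminus: "annihilate_poly A (- p) = - annihilate_poly A p"
  using annihilate_poly_add[of A p "- p"] by (simp add: eq_neg_iff_add_eq_0 add.commute)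

lemma annihilate_poly_diff: "annihilate_poly A (p - q) = annihilate_poly A p - annihilate_poly A q"
  using annihilate_poly_add[of A p "- q"] by (simp add: annihilate_poly_uminus)

lemma annihilate_poly_single:
  "annihilate_poly A (Poly_Mapping.single m c) =
     (\<Sum>\<alpha>\<in>#m. Poly_Mapping.single (m - {#\<alpha>#}) (c * A \<alpha>))"
  by (subst annihilate_poly_superset[of "{m}"]) auto

lemma annihilate_poly_mult:
  "annihilate_poly A (p * q) = annihilate_poly A p * q + p * annihilate_poly A q"
proof -
  have poly_ind: "P p" if "\<And>m c. P (Poly_Mapping.single m c)" "\<And>a b. P a \<Longrightarrow> P b \<Longrightarrow> P (a + b)"
    for P :: "sym_poly \<Rightarrow> bool" and p
  proof (induction p rule: update_induct)
    case const
    then show ?case using that(1)[of "{#}" 0] by simp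
  next
    case (update p k v)
    then have "Poly_Mapping.update k v p = p + Poly_Mapping.single k v"
      by (intro poly_mapping_eqI) (auto simp: lookup_update lookup_add lookup_single in_keys_iff when_def)
    with update that show ?case by auto
  qed
  have "annihilate_poly A (Poly_Mapping.single m c * Poly_Mapping.single n d) =
      annihilate_poly A (Poly_Mapping.single m c) * Poly_Mapping.single n d
      + Poly_Mapping.single m c * annihilate_poly A (Poly_Mapping.single n d)" for m n c d
  proof -
    have *: "m + n - {#\<alpha>#} = (m - {#\<alpha>#}) + n" if "\<alpha> \<in># m" for \<alpha>
      using diff_union_single_conv[OF that, of n] by (simp only: add.commute)
    have 1: "(\<Sum>\<alpha>\<in>#m. Poly_Mapping.single (m + n - {#\<alpha>#}) (c * d * A \<alpha>)) =
        (\<Sum>\<alpha>\<in>#m. Poly_Mapping.single (m - {#\<alpha>#} + n) (c * A \<alpha> * d))"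
      by (intro arg_cong[of _ _ sum_mset] image_mset_cong) (simp only: * mult_ac)
    have 2: "(\<Sum>\<alpha>\<in>#n. Poly_Mapping.single (m + n - {#\<alpha>#}) (c * d * A \<alpha>)) =
        (\<Sum>\<alpha>\<in>#n. Poly_Mapping.single (m + (n - {#\<alpha>#})) (c * (d * A \<alpha>)))"
      by (intro arg_cong[of _ _ sum_mset] image_mset_cong) (simp only: diff_union_single_conv mult_ac)
    show ?thesis
      unfolding annihilate_poly_single sum_mset_distrib_left sum_mset_distrib_right mult_single
        image_mset_union sum_mset.union 1 2 ..
  qed
  then have "annihilate_poly A (Poly_Mapping.single m c * q) =
      annihilate_poly A (Poly_Mapping.single m c) * q
      + Poly_Mapping.single m c * annihilate_poly A q" for m c
    by (induction q rule: poly_ind) (simp_all add: annihilate_poly_add algebra_simps)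
  then show ?thesis
    by (induction p rule: poly_ind) (simp_all add: annihilate_poly_add algebra_simps)
qed

lemma free_alg_closed:
  assumes "p \<in> carrier (free_alg V)" "q \<in> carrier (free_alg V)"
  shows "p + q \<in> carrier (free_alg V)" "p * q \<in> carrier (free_alg V)" "- p \<in> carrier (free_alg V)"
    "p - q \<in> carrier (free_alg V)"
proof -
  show "p + q \<in> carrier (free_alg V)" 
    using assms keys_add[of p q] by (fastforce simp: free_alg_def)
  show "- p \<in> carrier (free_alg V)"
    using assms by (auto simp: free_alg_def)
  show "p - q \<in> carrier (free_alg V)" 
    using assms keys_diff[of p q] by (fastforce simp: free_alg_def)
  show "p * q \<in> carrier (free_alg V)" 
    using assms keys_mult[of p q] by (fastforce simp: free_alg_def)
qed

lemma free_alg_simps [simp]: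
  "p \<otimes>\<^bsub>free_alg V\<^esub> q = p * q" "p \<oplus>\<^bsub>free_alg V\<^esub> q = p + q"
  "\<one>\<^bsub>free_alg V\<^esub> = 1" "\<zero>\<^bsub>free_alg V\<^esub> = 0"
  "0 \<in> carrier (free_alg V)" "1 \<in> carrier (free_alg V)"
  by (auto simp: free_alg_def)

lemma cring_free_alg: "cring (free_alg V)"
proof (rule cringI)
  show "abelian_group (free_alg V)"
  proof (rule abelian_groupI)
    fix x assume "x \<in> carrier (free_alg V)"
    then show "\<exists>y\<in>carrier (free_alg V). y \<oplus>\<^bsub>free_alg V\<^esub> x = \<zero>\<^bsub>free_alg V\<^esub>"
      using free_alg_closed(3)[of x V] by (intro bexI[of _ "- x"]) auto
  qed (auto intro: free_alg_closed simp: add_ac)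
  show "Group.comm_monoid (free_alg V)"
    by (rule comm_monoidI) (auto intro: free_alg_closed simp: mult_ac)
qed (auto simp: distrib_right)

interpretation free_alg: cring "free_alg V" for V
  by (rule cring_free_alg)

lemma linear_relations_carrier:
  assumes "mform.subspace V"
  shows "linear_relations V \<subseteq> carrier (free_alg V)"
proof -
  have "var \<alpha> \<in> carrier (free_alg V)" if "\<alpha> \<in> V" for \<alpha>
    using that by (auto simp: free_alg_def)
  moreover have "const c \<in> carrier (free_alg V)" for c
    by (auto simp: free_alg_def)
  ultimately show ?thesis
    using assms unfolding linear_relations_def
    by (auto intro!: free_alg_closed simp: mform.subspace_add mform.subspace_scale)
qed

lemma sym_ideal_ideal: "mform.subspace V \<Longrightarrow> ideal (sym_ideal V) (free_alg V)"
  unfolding sym_ideal_def by (intro free_alg.genideal_ideal linear_relations_carrier)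

lemma annihilate_poly_carrier:
  assumes "p \<in> carrier (free_alg V)"
  shows "annihilate_poly A p \<in> carrier (free_alg V)"
proof -
  have "m' \<in> Poly_Mapping.keys (annihilate_poly A p) \<Longrightarrow> \<exists>m\<in>Poly_Mapping.keys p. set_mset m' \<subseteq> set_mset m" for m'
  proof -
    have *: "Poly_Mapping.keys (\<Sum>\<alpha>\<in>#n. Poly_Mapping.single (m - {#\<alpha>#}) (c * A \<alpha>)) \<subseteq> {m'. set_mset m' \<subseteq> set_mset m}" for n m c
    proof (induction n)
      case (add x n)
      have "Poly_Mapping.keys (Poly_Mapping.single (m - {#x#}) (c * A x)) \<subseteq> {m'. set_mset m' \<subseteq> set_mset m}"
        by (auto dest: in_diffD)
      moreover have "Poly_Mapping.keys (\<Sum>\<alpha>\<in>#add_mset x n. Poly_Mapping.single (m - {#\<alpha>#}) (c * A \<alpha>)) \<subseteq>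
          Poly_Mapping.keys (Poly_Mapping.single (m - {#x#}) (c * A x)) \<union>
          Poly_Mapping.keys (\<Sum>\<alpha>\<in>#n. Poly_Mapping.single (m - {#\<alpha>#}) (c * A \<alpha>))"
        unfolding image_mset_add_mset sum_mset.add_mset by (rule keys_add)
      ultimately show ?case
        using add by (meson Un_least order_trans)
    qed simp
    assume "m' \<in> Poly_Mapping.keys (annihilate_poly A p)"
    then have "m' \<in> (\<Union>m\<in>Poly_Mapping.keys p. Poly_Mapping.keys
        (\<Sum>\<alpha>\<in>#m. Poly_Mapping.single (m - {#\<alpha>#}) (Poly_Mapping.lookup p m * A \<alpha>)))"
      unfolding annihilate_poly_def by (rule subsetD[OF keys_sum])
    with * show ?thesis by blast
  qed
  with assms show ?thesis unfolding free_alg_def by simp blast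
qed

lemma annihilate_poly_ideal:
  assumes V: "mform.subspace V"
    and A: "\<And>\<alpha> \<beta>. \<alpha> \<in> V \<Longrightarrow> \<beta> \<in> V \<Longrightarrow> A (\<alpha> + \<beta>) = A \<alpha> + A \<beta>"
      "\<And>c \<alpha>. \<alpha> \<in> V \<Longrightarrow> A (mform_scale c \<alpha>) = c * A \<alpha>"
    and p: "p \<in> sym_ideal V"
  shows "annihilate_poly A p \<in> sym_ideal V"
proof -
  interpret I: ideal "sym_ideal V" "free_alg V" by (rule sym_ideal_ideal[OF V])
  let ?N = "{p \<in> sym_ideal V. annihilate_poly A p \<in> sym_ideal V}"
  have zero: "0 \<in> sym_ideal V" using I.zero_closed by (simp add: free_alg_def)
  have add: "x + y \<in> sym_ideal V" if "x \<in> sym_ideal V" "y \<in> sym_ideal V" for x y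
    using I.a_closed[OF that] by (simp add: free_alg_def)
  have mult: "x * y \<in> sym_ideal V" if "x \<in> sym_ideal V" "y \<in> carrier (free_alg V)" for x y
    using I.I_r_closed[OF that] by (simp add: free_alg_def)
  have neg: "- x \<in> sym_ideal V" if "x \<in> sym_ideal V" for x
    using mult[OF that, of "-1"] free_alg_closed(3)[of 1 V] by (auto simp: free_alg_def)
  have inv: "inv\<^bsub>add_monoid (free_alg V)\<^esub> x = - x" if "x \<in> sym_ideal V" for x
  proof -
    have "x \<in> carrier (free_alg V)" "- x \<in> carrier (free_alg V)"
      using that I.a_subset neg by auto
    then have "\<ominus>\<^bsub>free_alg V\<^esub> x = - x"
      by (intro free_alg.minus_equality) (auto simp: free_alg_def)
    then show ?thesis by (simp add: a_inv_def)
  qed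
  have sub: "sym_ideal V \<subseteq> carrier (free_alg V)" by (rule I.a_subset)
  have "ideal ?N (free_alg V)"
  proof (rule idealI)
    show "subgroup ?N (add_monoid (free_alg V))"
    proof (rule subgroup.intro)
      fix x assume "x \<in> ?N"
      then show "inv\<^bsub>add_monoid (free_alg V)\<^esub> x \<in> ?N"
        using inv neg by (auto simp: annihilate_poly_uminus)
    qed (use sub zero add in \<open>auto simp: free_alg_def annihilate_poly_add\<close>)
    fix a x assume ax: "a \<in> ?N" "x \<in> carrier (free_alg V)"
    have D: "annihilate_poly A x \<in> carrier (free_alg V)" using annihilate_poly_carrier ax by blast
    have m: "u \<otimes>\<^bsub>free_alg V\<^esub> v = u * v" for u v by (simp add: free_alg_def)
    show "x \<otimes>\<^bsub>free_alg V\<^esub> a \<in> ?N" "a \<otimes>\<^bsub>free_alg V\<^esub> x \<in> ?N"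
      using ax D by (auto simp: m annihilate_poly_mult mult.commute[of x] mult.commute[of "annihilate_poly A x"] intro!: add mult)
  qed (rule free_alg.ring_axioms)
  moreover have "linear_relations V \<subseteq> ?N"
  proof
    fix r assume r: "r \<in> linear_relations V"
    then have "annihilate_poly A r = 0"
      using A by (auto simp: linear_relations_def annihilate_poly_diff annihilate_poly_add
          annihilate_poly_mult annihilate_poly_single mult_single single_add)
    with r show "r \<in> ?N"
      using zero free_alg.genideal_self[OF linear_relations_carrier[OF V]] by (auto simp: sym_ideal_def)
  qed
  ultimately have "sym_ideal V \<subseteq> ?N"
    unfolding sym_ideal_def[of V] by (rule free_alg.genideal_minimal)
  with p show ?thesis by blast
qed

lemma annihilate_sym_class:
  assumes V: "mform.subspace V"
    and A: "\<And>\<alpha> \<beta>. \<alpha> \<in> V \<Longrightarrow> \<beta> \<in> V \<Longrightarrow> A (\<alpha> + \<beta>) = A \<alpha> + A \<beta>"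
      "\<And>c \<alpha>. \<alpha> \<in> V \<Longrightarrow> A (mform_scale c \<alpha>) = c * A \<alpha>"
    and p: "p \<in> carrier (free_alg V)"
  shows "annihilate V A (sym_class V p) = sym_class V (annihilate_poly A p)"
proof -
  interpret I: ideal "sym_ideal V" "free_alg V" by (rule sym_ideal_ideal[OF V])
  have "sym_class V (annihilate_poly A q) = sym_class V (annihilate_poly A p)"
    if "q \<in> sym_class V p" for q
  proof -
    from that obtain h where h: "h \<in> sym_ideal V" "q = h + p"
      by (auto simp: sym_class_def a_r_coset_def' free_alg_def)
    then have "annihilate_poly A q \<in> sym_class V (annihilate_poly A p)"
      using annihilate_poly_ideal[OF V A h(1)]
      by (auto simp: sym_class_def a_r_coset_def' free_alg_def annihilate_poly_add)
    then show ?thesis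
      unfolding sym_class_def
      by (intro I.a_repr_independence'[symmetric] annihilate_poly_carrier p)
  qed
  moreover have "p \<in> sym_class V p"
    unfolding sym_class_def using p by (rule I.a_rcos_self)
  ultimately show ?thesis
    unfolding annihilate_def by blast
qed

text \<open>The operator does what its formula says on products; in particular it is well defined.\<close>

lemma annihilate_sym_prod:
  assumes V: "mform.subspace V"
    and A: "\<And>\<alpha> \<beta>. \<alpha> \<in> V \<Longrightarrow> \<beta> \<in> V \<Longrightarrow> A (\<alpha> + \<beta>) = A \<alpha> + A \<beta>"
      "\<And>c \<alpha>. \<alpha> \<in> V \<Longrightarrow> A (mform_scale c \<alpha>) = c * A \<alpha>"
    and \<alpha>s: "set \<alpha>s \<subseteq> V"
  shows "annihilate V A (sym_prod V \<alpha>s) =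
    (\<Oplus>\<^bsub>Sym V\<^esub>i\<in>{..<length \<alpha>s}.
       sym_scale V (A (\<alpha>s ! i)) (sym_prod V (take i \<alpha>s @ drop (Suc i) \<alpha>s)))"
proof -
  interpret I: ideal "sym_ideal V" "free_alg V" by (rule sym_ideal_ideal[OF V])
  interpret S: ring "Sym V" unfolding Sym_def by (rule I.quotient_is_ring)
  have add: "sym_class V (p + q) = sym_class V p \<oplus>\<^bsub>Sym V\<^esub> sym_class V q"
    if "p \<in> carrier (free_alg V)" "q \<in> carrier (free_alg V)" for p q
    using I.a_rcos_sum[OF that] by (simp add: sym_class_def Sym_def FactRing_def free_alg_def)
  have mult: "sym_class V (p * q) = sym_class V p \<otimes>\<^bsub>Sym V\<^esub> sym_class V q"
    if "p \<in> carrier (free_alg V)" "q \<in> carrier (free_alg V)" for p q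
    using I.rcoset_mult_add[OF that] by (simp add: sym_class_def Sym_def FactRing_def free_alg_def)
  have cl: "sym_class V p \<in> carrier (Sym V)" if "p \<in> carrier (free_alg V)" for p
    using that by (auto simp: sym_class_def Sym_def FactRing_def A_RCOSETS_def')
  have zero: "sym_class V 0 = \<zero>\<^bsub>Sym V\<^esub>"
    by (auto simp: sym_class_def Sym_def FactRing_def a_r_coset_def' free_alg_def)
  let ?m = "\<lambda>i. mset (take i \<alpha>s @ drop (Suc i) \<alpha>s)"
  have car: "Poly_Mapping.single (?m i) c \<in> carrier (free_alg V)" for i c
    using \<alpha>s by (auto simp: free_alg_def dest: in_set_takeD in_set_dropD)
  have car2: "(\<Sum>i\<in>F. Poly_Mapping.single (?m i) (A (\<alpha>s ! i))) \<in> carrier (free_alg V)" for F :: "nat set"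
    by (induction F rule: infinite_finite_induct) (use car in \<open>auto intro!: free_alg_closed\<close>)
  have cst: "const c \<in> carrier (free_alg V)" for c by (auto simp: free_alg_def)
  have sc: "sym_scale V c (sym_prod V (take i \<alpha>s @ drop (Suc i) \<alpha>s)) = sym_class V (Poly_Mapping.single (?m i) c)" for i c
    unfolding sym_scale_def sym_prod_def by (subst mult[symmetric]) (use car cst in \<open>simp_all add: mult_single\<close>)
  have "mset \<alpha>s - {#\<alpha>s ! i#} = ?m i" if "i < length \<alpha>s" for i
    using arg_cong[OF id_take_nth_drop[OF that], of mset] by simp
  then have "annihilate_poly A (Poly_Mapping.single (mset \<alpha>s) 1) =
      (\<Sum>i<length \<alpha>s. Poly_Mapping.single (?m i) (A (\<alpha>s ! i)))"
    by (simp add: annihilate_poly_single mset_map[symmetric] sum_mset_sum_list sum_list_sum_nth atLeast0LessThan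
        del: mset_map mset_append)
  moreover have "sym_class V (\<Sum>i\<in>F. Poly_Mapping.single (?m i) (A (\<alpha>s ! i))) =
      (\<Oplus>\<^bsub>Sym V\<^esub>i\<in>F. sym_class V (Poly_Mapping.single (?m i) (A (\<alpha>s ! i))))" if "finite F" for F
    using that
    by (induction F rule: finite_induct) (simp_all add: zero add[OF car car2] cl[OF car] del: mset_append)
  moreover have "Poly_Mapping.single (mset \<alpha>s) 1 \<in> carrier (free_alg V)"
    using \<alpha>s by (auto simp: free_alg_def)
  ultimately show ?thesis
    unfolding sc by (simp add: sym_prod_def annihilate_sym_class[OF V A] del: mset_append)
qed

definition create :: "mform set \<Rightarrow> mform \<Rightarrow> sym_poly set \<Rightarrow> sym_poly set" where
  "create V \<beta> w = sym_class V (var \<beta>) \<otimes>\<^bsub>Sym V\<^esub> w"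


section \<open>The operators\<close>

definition W :: "sym_poly set ring" where
  "W = Sym K_space"

definition K_bd :: "proj_line set \<Rightarrow> mform set" where
  "K_bd D = {\<alpha> \<in> K_space. form_regular_on (frontier D) \<alpha>}"

definition W_bd :: "proj_line set \<Rightarrow> sym_poly set ring" where
  "W_bd D = Sym (K_bd D)"

text \<open>A decomposition \<open>\<phi> = \<phi>\<^sub>1 + \<phi>\<^sub>2\<close> with \<open>\<phi>\<^sub>1\<close> regular on \<open>S\<close> and \<open>\<phi>\<^sub>2\<close> regular on \<open>T\<close>.  In the uses below
  it exists and is unique up to constants, which act by zero.\<close>

definition split_fun :: "proj_line set \<Rightarrow> proj_line set \<Rightarrow> mfun \<Rightarrow> mfun \<times> mfun" where
  "split_fun S T \<phi> = (SOME (\<phi>1, \<phi>2). \<phi> = \<phi>1 + \<phi>2 \<and> fun_regular_on S \<phi>1 \<and> fun_regular_on T \<phi>2)"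

text \<open>Only the summand \<open>\<phi>\<^sub>1\<close> contributes a term \<open>d\<phi>\<^sub>1 \<otimes>\<^sup>s \<dots>\<close>.  For \<open>\<phi>\<close> regular along the boundary of \<open>D\<close> both
  summands in \<open>Phi_disc\<close> are required to be regular there as well.  \<open>Phi_right P\<close> is the operator
  \<open>\<Phi>\<^sub>P\<close>, and \<open>Phi_left Q\<close> is the one with the index \<open>Q\<close> on the left of \<open>\<Phi>\<close>.\<close>

definition Phi_disc :: "proj_line set \<Rightarrow> mfun \<Rightarrow> sym_poly set \<Rightarrow> sym_poly set" where
  "Phi_disc D \<phi> w =
     (let (\<phi>1, \<phi>2) = split_fun (exterior D \<union> frontier D) (D \<union> frontier D) \<phi>;
          V = K_bd D;
          A = (\<lambda>f \<alpha>. - (1 / (2 * pi * \<i>) * boundary_integral D (f \<cdot> \<alpha>)))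
      in (annihilate V (A \<phi>1) w \<oplus>\<^bsub>Sym V\<^esub> create V (differential \<phi>1) w)
           \<oplus>\<^bsub>Sym V\<^esub> annihilate V (A \<phi>2) w)"

definition Phi_right :: "proj_line \<Rightarrow> mfun \<Rightarrow> sym_poly set \<Rightarrow> sym_poly set" where
  "Phi_right P \<phi> w =
     (let (\<phi>1, \<phi>2) = split_fun {P} (- {P}) \<phi>;
          V = K_space;
          A = (\<lambda>f \<alpha>. Res P (f \<cdot> \<alpha>))
      in (annihilate V (A \<phi>1) w \<oplus>\<^bsub>Sym V\<^esub> create V (differential \<phi>1) w)
           \<oplus>\<^bsub>Sym V\<^esub> annihilate V (A \<phi>2) w)"

definition Phi_left :: "proj_line \<Rightarrow> mfun \<Rightarrow> sym_poly set \<Rightarrow> sym_poly set" where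
  "Phi_left Q \<phi> w =
     (let (\<phi>1, \<phi>2) = split_fun (- {Q}) {Q} \<phi>;
          V = K_space;
          A = (\<lambda>f \<alpha>. - Res Q (f \<cdot> \<alpha>))
      in (annihilate V (A \<phi>1) w \<oplus>\<^bsub>Sym V\<^esub> create V (differential \<phi>1) w)
           \<oplus>\<^bsub>Sym V\<^esub> annihilate V (A \<phi>2) w)"

end

theory Submission
  imports Defs
begin

text \<open>
  Each operator is the sum of an annihilation operator, given by the functional
  \<open>\<alpha> \<mapsto> L(\<phi> \<alpha>)\<close>, and of the multiplication by \<open>d\<phi>\<^sub>1\<close>, where \<open>\<phi> = \<phi>\<^sub>1 + \<phi>\<^sub>2\<close> is the chosen
  decomposition and \<open>L\<close> is \<open>Res\<^sub>P\<close>, \<open>- Res\<^sub>O\<close> or \<open>- (1 / 2\<pi>\<i>) \<integral>\<^bsub>\<partial>D\<^esub>\<close>.  Annihilation operators are derivations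
  of the symmetric algebra that commute with one another, and multiplications commute as well, so
  the commutator is the scalar \<open>L(\<phi> d\<psi>\<^sub>1) - L(\<psi> d\<phi>\<^sub>1)\<close>.  Write \<open>\<langle>\<phi>, \<psi>\<rangle> = L(\<phi> d\<psi>)\<close>.  This pairing
  is antisymmetric, because \<open>\<phi> d\<psi> + \<psi> d\<phi>\<close> is exact, and \<open>\<langle>\<phi>\<^sub>1, \<psi>\<^sub>1\<rangle> = \<langle>\<phi>\<^sub>2, \<psi>\<^sub>2\<rangle> = 0\<close>: in both cases all
  poles of the form lie on one side of the boundary of the disc, respectively at the point or away
  from it.  Hence the scalar is \<open>\<langle>\<phi>\<^sub>2, \<psi>\<^sub>1\<rangle> + \<langle>\<phi>\<^sub>1, \<psi>\<^sub>2\<rangle> = \<langle>\<phi>, \<psi>\<rangle>\<close>.  This is carried out once, in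
  the locale \<open>residue_functional\<close> (lemma \<open>field_op_commutator\<close>).

  What remains is analysis.  The decompositions exist because a meromorphic function has finitely
  many poles, and the polar part at each of them, a polynomial in \<open>1 / (z - a)\<close> or in \<open>z\<close>, has no
  other pole (\<open>exists_split\<close>).  The vanishing for a point is the residue theorem for a form with a
  single pole (\<open>Res_single_pole\<close>): in a coordinate that moves the pole to infinity the form has an
  entire primitive.

  The vanishing for a disc is Cauchy's theorem on the two sides of the boundary curve
  (\<open>boundary_integral_regular\<close>).  The coordinate \<open>u = 1 / (z - a)\<close>, with \<open>a\<close> on the side where the
  form may have poles, turns the boundary into a smooth simple closed curve in the plane, even if it
  passes through infinity.  By the Jordan curve theorem that side becomes the outside of the curve,
  where winding numbers vanish, and the global Cauchy theorem applies (\<open>Cauchy_loop\<close>).  This argument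
  requires both sides to be nonempty; the exterior is nonempty because the disc is connected,
  whereas the complement of the curve is not (\<open>complement_disconnected\<close>).
\<close>

section \<open>Creation and annihilation in the symmetric algebra\<close>

lemma single_add_mset_eq:
  "Poly_Mapping.single (add_mset \<alpha> m) c = Poly_Mapping.single m c * var \<alpha>"
  by (simp add: mult_single)

lemma sym_poly_induct [case_names const times_var add]:
  fixes p :: sym_poly
  assumes const: "\<And>c. P (const c)"
    and times_var: "\<And>p \<alpha>. P p \<Longrightarrow> P (p * var \<alpha>)"
    and add: "\<And>p q. P p \<Longrightarrow> P q \<Longrightarrow> P (p + q)"
  shows "P p"
proof (induction p rule: update_induct)
  case const
  show ?case using assms(1)[of 0] by simp
next
  case (update p m c)
  have "P (Poly_Mapping.single m c)"
  proof (induction m)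
    case empty
    show ?case by (rule assms(1))
  next
    case (add \<alpha> m)
    then have "P (Poly_Mapping.single m c * var \<alpha>)" by (rule times_var)
    then show ?case by (subst single_add_mset_eq)
  qed
  moreover have "Poly_Mapping.update m c p = p + Poly_Mapping.single m c"
    using update by (intro poly_mapping_eqI)
      (auto simp: lookup_update lookup_add lookup_single in_keys_iff when_def)
  ultimately show ?case
    using update add by simp
qed

lemma annihilate_poly_const [simp]: "annihilate_poly A (const c) = 0"
  by (simp add: annihilate_poly_single)

lemma annihilate_poly_var [simp]: "annihilate_poly A (var \<alpha>) = const (A \<alpha>)"
  by (simp add: annihilate_poly_single)

lemma annihilate_poly_commute:
  "annihilate_poly A (annihilate_poly B p) = annihilate_poly B (annihilate_poly A p)"
  by (induction p rule: sym_poly_induct)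
    (simp_all add: annihilate_poly_mult annihilate_poly_add add_ac)

lemma annihilate_poly_add_functional:
  "annihilate_poly (\<lambda>\<alpha>. A \<alpha> + B \<alpha>) p = annihilate_poly A p + annihilate_poly B p"
  by (induction p rule: sym_poly_induct)
    (simp_all add: annihilate_poly_mult annihilate_poly_add single_add algebra_simps)

text \<open>The sum of the annihilation by \<open>A\<close> and the multiplication by \<open>\<beta>\<close>, on the polynomials that
  represent elements of the symmetric algebra.\<close>

definition field_poly :: "(mform \<Rightarrow> complex) \<Rightarrow> mform \<Rightarrow> sym_poly \<Rightarrow> sym_poly" where
  "field_poly A \<beta> p = annihilate_poly A p + var \<beta> * p"

text \<open>The canonical commutation relation.  It holds for polynomials, before passing to classes, and
  for arbitrary functions \<open>A\<close> and \<open>B\<close>, linear or not.\<close>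

lemma field_poly_commutator:
  "field_poly A \<beta> (field_poly B \<gamma> p) - field_poly B \<gamma> (field_poly A \<beta> p)
     = const (A \<gamma> - B \<beta>) * p"
  by (simp add: field_poly_def annihilate_poly_add annihilate_poly_mult single_diff
      annihilate_poly_commute[of A B p] algebra_simps)

lemma field_poly_carrier:
  assumes "\<beta> \<in> V" "p \<in> carrier (free_alg V)"
  shows "field_poly A \<beta> p \<in> carrier (free_alg V)"
proof -
  have "var \<beta> \<in> carrier (free_alg V)"
    using assms(1) by (auto simp: free_alg_def)
  then show ?thesis
    using assms(2) unfolding field_poly_def by (intro free_alg_closed annihilate_poly_carrier)
qed

lemma const_carrier: "const c \<in> carrier (free_alg V)"
  by (auto simp: free_alg_def)

context
  fixes V :: "mform set"
  assumes V: "mform.subspace V"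
begin

lemma sym_class_hom:
  assumes "p \<in> carrier (free_alg V)" "q \<in> carrier (free_alg V)"
  shows sym_class_closed: "sym_class V p \<in> carrier (Sym V)"
    and sym_class_add: "sym_class V p \<oplus>\<^bsub>Sym V\<^esub> sym_class V q = sym_class V (p + q)"
    and sym_class_mult: "sym_class V p \<otimes>\<^bsub>Sym V\<^esub> sym_class V q = sym_class V (p * q)"
    and sym_class_minus: "sym_class V p \<ominus>\<^bsub>Sym V\<^esub> sym_class V q = sym_class V (p - q)"
proof -
  interpret I: ideal "sym_ideal V" "free_alg V" by (rule sym_ideal_ideal[OF V])
  interpret S: ring "Sym V" unfolding Sym_def by (rule I.quotient_is_ring)
  have cl: "sym_class V r \<in> carrier (Sym V)" if "r \<in> carrier (free_alg V)" for r
    using that by (auto simp: sym_class_def Sym_def FactRing_def A_RCOSETS_def')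
  have add: "sym_class V r \<oplus>\<^bsub>Sym V\<^esub> sym_class V s = sym_class V (r + s)"
    if "r \<in> carrier (free_alg V)" "s \<in> carrier (free_alg V)" for r s
    using I.a_rcos_sum[OF that] by (simp add: sym_class_def Sym_def FactRing_def free_alg_def)
  show "sym_class V p \<in> carrier (Sym V)" by (rule cl) fact
  show "sym_class V p \<oplus>\<^bsub>Sym V\<^esub> sym_class V q = sym_class V (p + q)" by (intro add assms)
  show "sym_class V p \<otimes>\<^bsub>Sym V\<^esub> sym_class V q = sym_class V (p * q)"
    using I.rcoset_mult_add[OF assms]
    by (simp add: sym_class_def Sym_def FactRing_def free_alg_def)
  have pq: "p - q \<in> carrier (free_alg V)" using assms by (intro free_alg_closed)
  have "sym_class V p = sym_class V (p - q) \<oplus>\<^bsub>Sym V\<^esub> sym_class V q"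
    using add[OF pq assms(2)] by simp
  then show "sym_class V p \<ominus>\<^bsub>Sym V\<^esub> sym_class V q = sym_class V (p - q)"
    using cl[OF pq] cl[OF assms(2)] by (simp add: S.minus_eq S.a_assoc S.r_neg)
qed

lemma Sym_carrierE:
  assumes "w \<in> carrier (Sym V)"
  obtains p where "p \<in> carrier (free_alg V)" "w = sym_class V p"
  using assms by (auto simp: sym_class_def Sym_def FactRing_def A_RCOSETS_def')

end

section \<open>Local expressions of functions and forms\<close>

lemma analytic_eq_nhds:
  fixes f g :: "complex \<Rightarrow> complex"
  assumes "f analytic_on {z}" "g analytic_on {z}" "\<forall>\<^sub>F w in at z. f w = g w"
  shows "\<forall>\<^sub>F w in nhds z. f w = g w"
proof -
  have "f \<midarrow>z\<rightarrow> f z" "g \<midarrow>z\<rightarrow> g z"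
    using assms(1,2) by (simp_all add: analytic_at_imp_isCont isContD)
  moreover have "f \<midarrow>z\<rightarrow> g z"
    using \<open>g \<midarrow>z\<rightarrow> g z\<close> assms(3) by (simp add: tendsto_cong)
  ultimately have "f z = g z" by (blast intro: LIM_unique)
  with assms(3) show ?thesis by (simp add: eventually_nhds_conv_at)
qed

lemma nicely_meromorphic_analytic_iff:
  "f nicely_meromorphic_on {z} \<Longrightarrow> f analytic_on {z} \<longleftrightarrow> \<not> is_pole f z"
  using nicely_meromorphic_on_imp_analytic_at[of f "{z}" z] analytic_at_imp_no_pole by auto

lemma nicely_meromorphic_transform_analytic:
  assumes "f nicely_meromorphic_on {z}" "g analytic_on {z}" "\<forall>\<^sub>F w in at z. f w = g w"
  shows "f analytic_on {z}"
proof -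
  have "\<not> is_pole f z"
    using assms(2,3) is_pole_cong[of f g z z] analytic_at_imp_no_pole by auto
  then show ?thesis using assms(1) nicely_meromorphic_analytic_iff by blast
qed

lemma eventually_analytic_at:
  fixes f :: "complex \<Rightarrow> complex"
  assumes "f meromorphic_on {z}"
  shows "\<forall>\<^sub>F w in at z. f analytic_on {w}"
proof -
  obtain r where r: "r > 0" "f analytic_on ball z r - {z}"
    using assms by (auto simp: meromorphic_at_iff isolated_singularity_at_def)
  have "\<forall>\<^sub>F w in at z. w \<in> ball z r - {z}"
    using r(1) by (intro eventually_at_in_open) auto
  then show ?thesis
    by eventually_elim (use r(2) analytic_on_subset in blast)
qed

lemma eventually_remove_sings_eq_meromorphic:
  "f meromorphic_on {z} \<Longrightarrow> \<forall>\<^sub>F w in at z. remove_sings f w = f w"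
  by (simp add: meromorphic_at_iff eventually_remove_sings_eq_at)

lemma eventually_remove_sings_at_inverse:
  assumes "(\<lambda>w. f (1 / w)) meromorphic_on {0}"
  shows "\<forall>\<^sub>F w in at 0. remove_sings f (1 / w) = f (1 / w)"
  using eventually_remove_sings_inverse[OF assms] by eventually_elim auto

lemma eventually_nonzero_at_0: "\<forall>\<^sub>F w::complex in at 0. w \<noteq> 0"
  by (simp add: eventually_at_filter)

lemma mfun_props:
  "mf_val \<phi> nicely_meromorphic_on UNIV" "mf_val \<phi> meromorphic_on A"
  "(\<lambda>w. mf_val \<phi> (1 / w)) meromorphic_on {0}"
  using mf_val[of \<phi>] by (auto dest: nicely_imp_meromorphic intro: meromorphic_on_subset)

lemma mform_props:
  "coeff \<alpha> nicely_meromorphic_on UNIV" "coeff \<alpha> meromorphic_on A"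
  "(\<lambda>w. coeff \<alpha> (1 / w)) meromorphic_on {0}"
  "(\<lambda>w. - coeff \<alpha> (1 / w) / w\<^sup>2) meromorphic_on {0}"
  using coeff[of \<alpha>] form_at_infinity_iff[of "coeff \<alpha>"]
  by (auto dest: nicely_imp_meromorphic intro: meromorphic_on_subset)

text \<open>Functions and forms near a point \<open>P\<close> are expressed in the affine coordinate \<open>z\<close> if \<open>P\<close> is finite,
  and in the coordinate \<open>w = 1 / z\<close> at infinity; \<open>germ_pt P\<close> is the coordinate of \<open>P\<close> itself.  The
  expressions are normalised so that they are analytic at \<open>germ_pt P\<close> unless they have a pole
  there.  The operations on functions and forms are then the expected ones in a punctured
  neighbourhood of \<open>germ_pt P\<close>.\<close>

definition germ_pt :: "proj_line \<Rightarrow> complex" where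
  "germ_pt P = (case P of Fin z \<Rightarrow> z | Infty \<Rightarrow> 0)"

definition fun_germ :: "proj_line \<Rightarrow> mfun \<Rightarrow> complex \<Rightarrow> complex" where
  "fun_germ P \<phi> = (case P of Fin z \<Rightarrow> mf_val \<phi> | Infty \<Rightarrow> remove_sings (\<lambda>w. mf_val \<phi> (1 / w)))"

definition form_germ :: "proj_line \<Rightarrow> mform \<Rightarrow> complex \<Rightarrow> complex" where
  "form_germ P \<alpha> = (case P of Fin z \<Rightarrow> coeff \<alpha> | Infty \<Rightarrow> coeff_inf \<alpha>)"

lemma germ_simps [simp]:
  "germ_pt (Fin z) = z" "germ_pt Infty = 0"
  "fun_germ (Fin z) \<phi> = mf_val \<phi>"
  "fun_germ Infty \<phi> = remove_sings (\<lambda>w. mf_val \<phi> (1 / w))"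
  "form_germ (Fin z) \<alpha> = coeff \<alpha>" "form_germ Infty \<alpha> = coeff_inf \<alpha>"
  by (simp_all add: germ_pt_def fun_germ_def form_germ_def)

lemma fun_germ_nice: "fun_germ P \<phi> nicely_meromorphic_on {germ_pt P}"
  by (cases P) (auto intro: remove_sings_nicely_meromorphic mfun_props
      nicely_meromorphic_on_subset[OF mfun_props(1)])

lemma form_germ_nice: "form_germ P \<alpha> nicely_meromorphic_on {germ_pt P}"
proof (cases P)
  case Infty
  have "remove_sings (\<lambda>w. - coeff \<alpha> (1 / w) / w\<^sup>2) nicely_meromorphic_on {0}"
    by (intro remove_sings_nicely_meromorphic mform_props)
  with Infty show ?thesis by (simp only: germ_simps coeff_inf_def)
qed (auto intro: nicely_meromorphic_on_subset[OF mform_props(1)])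

lemma fun_germ_meromorphic: "fun_germ P \<phi> meromorphic_on {germ_pt P}"
  using fun_germ_nice by (rule nicely_imp_meromorphic)

lemma form_germ_meromorphic: "form_germ P \<alpha> meromorphic_on {germ_pt P}"
  using form_germ_nice by (rule nicely_imp_meromorphic)

lemma fun_regular_on_iff:
  "fun_regular_on S \<phi> \<longleftrightarrow> (\<forall>P\<in>S. fun_germ P \<phi> analytic_on {germ_pt P})"
  unfolding fun_regular_on_def nicely_meromorphic_analytic_iff[OF fun_germ_nice]
proof (intro ball_cong refl)
  fix P
  have "isolated_singularity_at (\<lambda>w. mf_val \<phi> (1 / w)) 0"
    using mfun_props(3)[of \<phi>] by (simp add: meromorphic_at_iff)
  then show "(case P of Fin z \<Rightarrow> \<not> is_pole (mf_val \<phi>) z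
        | Infty \<Rightarrow> \<not> is_pole (\<lambda>w. mf_val \<phi> (1 / w)) 0) = (\<not> is_pole (fun_germ P \<phi>) (germ_pt P))"
    by (cases P) simp_all
qed

lemma form_regular_on_iff:
  "form_regular_on S \<alpha> \<longleftrightarrow> (\<forall>P\<in>S. form_germ P \<alpha> analytic_on {germ_pt P})"
  unfolding form_regular_on_def nicely_meromorphic_analytic_iff[OF form_germ_nice]
  by (intro ball_cong refl) (simp split: proj_line.split)

lemma Res_germ: "Res P \<alpha> = residue (form_germ P \<alpha>) (germ_pt P)"
  by (simp add: Res_def split: proj_line.split)

lemma eventually_coeff_inf: "\<forall>\<^sub>F w in at 0. coeff_inf \<alpha> w = - coeff \<alpha> (1 / w) / w\<^sup>2"
  unfolding coeff_inf_def by (rule eventually_remove_sings_eq_meromorphic[OF mform_props(4)])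

lemma eventually_fun_inf:
  "\<forall>\<^sub>F w in at 0. fun_germ Infty \<phi> w = mf_val \<phi> (1 / w)"
  by (simp add: eventually_remove_sings_eq_meromorphic[OF mfun_props(3)])

lemma fun_germ_add:
  "\<forall>\<^sub>F w in at (germ_pt P). fun_germ P (\<phi> + \<psi>) w = fun_germ P \<phi> w + fun_germ P \<psi> w"
proof (cases P)
  case (Fin z)
  then show ?thesis
    by (auto simp: plus_mfun.rep_eq
        intro!: eventually_remove_sings_eq_meromorphic meromorphic_intros mfun_props)
next
  case Infty
  have "\<forall>\<^sub>F w in at 0. remove_sings (\<lambda>z. mf_val \<phi> z + mf_val \<psi> z) (1 / w)
      = mf_val \<phi> (1 / w) + mf_val \<psi> (1 / w)"
    by (rule eventually_remove_sings_at_inverse) (intro meromorphic_intros mfun_props)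
  with eventually_fun_inf[of \<phi>] eventually_fun_inf[of \<psi>] eventually_fun_inf[of "\<phi> + \<psi>"]
  show ?thesis
    unfolding Infty germ_simps(2) by eventually_elim (simp only: plus_mfun.rep_eq)
qed

lemma form_germ_add:
  "\<forall>\<^sub>F w in at (germ_pt P). form_germ P (\<alpha> + \<beta>) w = form_germ P \<alpha> w + form_germ P \<beta> w"
proof (cases P)
  case (Fin z)
  then show ?thesis
    by (auto simp: plus_mform.rep_eq
        intro!: eventually_remove_sings_eq_meromorphic meromorphic_intros mform_props)
next
  case Infty
  have "\<forall>\<^sub>F w in at 0. remove_sings (\<lambda>z. coeff \<alpha> z + coeff \<beta> z) (1 / w)
      = coeff \<alpha> (1 / w) + coeff \<beta> (1 / w)"
    by (rule eventually_remove_sings_at_inverse) (intro meromorphic_intros mform_props)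
  with eventually_coeff_inf[of \<alpha>] eventually_coeff_inf[of \<beta>] eventually_coeff_inf[of "\<alpha> + \<beta>"]
  show ?thesis
    unfolding Infty germ_simps
    by eventually_elim (simp add: plus_mform.rep_eq diff_divide_distrib)
qed

lemma form_germ_scale:
  "\<forall>\<^sub>F w in at (germ_pt P). form_germ P (mform_scale c \<alpha>) w = c * form_germ P \<alpha> w"
proof (cases P)
  case (Fin z)
  then show ?thesis by (simp add: mform_scale.rep_eq)
next
  case Infty
  show ?thesis
    using eventually_coeff_inf[of \<alpha>] eventually_coeff_inf[of "mform_scale c \<alpha>"]
    unfolding Infty germ_simps by eventually_elim (simp add: mform_scale.rep_eq)
qed

lemma form_germ_times:
  "\<forall>\<^sub>F w in at (germ_pt P). form_germ P (\<phi> \<cdot> \<alpha>) w = fun_germ P \<phi> w * form_germ P \<alpha> w"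
proof (cases P)
  case (Fin z)
  then show ?thesis
    by (auto simp: fun_times_form.rep_eq
        intro!: eventually_remove_sings_eq_meromorphic meromorphic_intros mform_props mfun_props)
next
  case Infty
  have "\<forall>\<^sub>F w in at 0. remove_sings (\<lambda>z. mf_val \<phi> z * coeff \<alpha> z) (1 / w)
      = mf_val \<phi> (1 / w) * coeff \<alpha> (1 / w)"
    by (rule eventually_remove_sings_at_inverse) (intro meromorphic_intros mform_props mfun_props)
  with eventually_fun_inf[of \<phi>] eventually_coeff_inf[of \<alpha>] eventually_coeff_inf[of "\<phi> \<cdot> \<alpha>"]
  show ?thesis
    unfolding Infty germ_simps(2,6) by eventually_elim (simp add: fun_times_form.rep_eq)
qed

lemma form_germ_differential:
  "\<forall>\<^sub>F w in at (germ_pt P). form_germ P (differential \<phi>) w = deriv (fun_germ P \<phi>) w"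
proof (cases P)
  case (Fin z)
  then show ?thesis
    by (auto simp: differential.rep_eq
        intro!: eventually_remove_sings_eq_meromorphic meromorphic_intros mfun_props)
next
  case Infty
  let ?f = "mf_val \<phi>"
  have "\<forall>\<^sub>F w in at 0. (\<lambda>w. ?f (1 / w)) analytic_on {w}"
    by (intro eventually_analytic_at mfun_props)
  with eventually_coeff_inf[of "differential \<phi>"] eventually_nonzero_at_0
    eventually_remove_sings_inverse[OF mfun_props(3)[of \<phi>]]
  have "\<forall>\<^sub>F w in at 0. coeff_inf (differential \<phi>) w = deriv (remove_sings (\<lambda>w. ?f (1 / w))) w"
  proof eventually_elim
    case (elim w)
    have "(?f has_field_derivative deriv ?f (1 / w)) (at (1 / w))"
      using elim by (simp add: analytic_on_imp_differentiable_at DERIV_deriv_iff_field_differentiable)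
    from DERIV_chain2[where g = "\<lambda>w. 1 / w" and x = w, OF this] elim(2)
    have "((\<lambda>w. ?f (1 / w)) has_field_derivative deriv ?f (1 / w) * (- 1 / w\<^sup>2)) (at w)"
      by (force intro: derivative_eq_intros simp: power2_eq_square)
    moreover have "remove_sings (deriv ?f) (1 / w) = deriv ?f (1 / w)"
      using elim by (intro remove_sings_at_analytic analytic_deriv)
    ultimately show ?case
      using elim by (simp add: DERIV_imp_deriv differential.rep_eq)
  qed
  then show ?thesis
    unfolding Infty germ_simps .
qed

lemma mform_eqI:
  assumes "\<And>P. \<forall>\<^sub>F w in at (germ_pt P). form_germ P \<alpha> w = form_germ P \<beta> w"
  shows "\<alpha> = \<beta>"
proof -
  have "remove_sings (coeff \<alpha>) = remove_sings (coeff \<beta>)"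
  proof
    fix z
    show "remove_sings (coeff \<alpha>) z = remove_sings (coeff \<beta>) z"
      by (rule remove_sings_cong) (use assms[of "Fin z"] in simp_all)
  qed
  then show ?thesis
    by (simp add: remove_sings_nicely_id mform_props coeff_inject)
qed

lemma fun_times_form_add_right: "\<phi> \<cdot> (\<alpha> + \<beta>) = \<phi> \<cdot> \<alpha> + \<phi> \<cdot> \<beta>"
proof (rule mform_eqI)
  fix P
  show "\<forall>\<^sub>F w in at (germ_pt P). form_germ P (\<phi> \<cdot> (\<alpha> + \<beta>)) w = form_germ P (\<phi> \<cdot> \<alpha> + \<phi> \<cdot> \<beta>) w"
    using form_germ_times[of P \<phi> "\<alpha> + \<beta>"] form_germ_times[of P \<phi> \<alpha>] form_germ_times[of P \<phi> \<beta>]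
      form_germ_add[of P \<alpha> \<beta>] form_germ_add[of P "\<phi> \<cdot> \<alpha>" "\<phi> \<cdot> \<beta>"]
    by eventually_elim (simp add: distrib_left)
qed

lemma fun_times_form_add_left: "(\<phi> + \<psi>) \<cdot> \<alpha> = \<phi> \<cdot> \<alpha> + \<psi> \<cdot> \<alpha>"
proof (rule mform_eqI)
  fix P
  show "\<forall>\<^sub>F w in at (germ_pt P). form_germ P ((\<phi> + \<psi>) \<cdot> \<alpha>) w = form_germ P (\<phi> \<cdot> \<alpha> + \<psi> \<cdot> \<alpha>) w"
    using form_germ_times[of P "\<phi> + \<psi>" \<alpha>] form_germ_times[of P \<phi> \<alpha>] form_germ_times[of P \<psi> \<alpha>]
      fun_germ_add[of P \<phi> \<psi>] form_germ_add[of P "\<phi> \<cdot> \<alpha>" "\<psi> \<cdot> \<alpha>"]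
    by eventually_elim (simp add: distrib_right)
qed

lemma fun_times_form_scale: "\<phi> \<cdot> mform_scale c \<alpha> = mform_scale c (\<phi> \<cdot> \<alpha>)"
proof (rule mform_eqI)
  fix P
  show "\<forall>\<^sub>F w in at (germ_pt P).
      form_germ P (\<phi> \<cdot> mform_scale c \<alpha>) w = form_germ P (mform_scale c (\<phi> \<cdot> \<alpha>)) w"
    using form_germ_times[of P \<phi> "mform_scale c \<alpha>"] form_germ_times[of P \<phi> \<alpha>]
      form_germ_scale[of P c \<alpha>] form_germ_scale[of P c "\<phi> \<cdot> \<alpha>"]
    by eventually_elim simp
qed

lemma eventually_fun_germ_analytic: "\<forall>\<^sub>F w in at (germ_pt P). fun_germ P \<phi> analytic_on {w}"
  by (intro eventually_analytic_at fun_germ_meromorphic)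

lemma differential_add: "differential (\<phi> + \<psi>) = differential \<phi> + differential \<psi>"
proof (rule mform_eqI)
  fix P
  \<comment> \<open>The identity for germs holds on a punctured disc, where it can be differentiated.\<close>
  obtain r where r: "r > 0" "\<And>w. w \<in> ball (germ_pt P) r - {germ_pt P} \<Longrightarrow>
      fun_germ P (\<phi> + \<psi>) w = fun_germ P \<phi> w + fun_germ P \<psi> w"
    using fun_germ_add[of P \<phi> \<psi>] by (auto simp: eventually_at dist_commute)
  have "\<forall>\<^sub>F w in at (germ_pt P). w \<in> ball (germ_pt P) r - {germ_pt P}"
    using r(1) by (intro eventually_at_in_open) auto
  then show "\<forall>\<^sub>F w in at (germ_pt P).
      form_germ P (differential (\<phi> + \<psi>)) w = form_germ P (differential \<phi> + differential \<psi>) w"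
    using eventually_fun_germ_analytic[of P \<phi>] eventually_fun_germ_analytic[of P \<psi>]
      form_germ_add[of P "differential \<phi>" "differential \<psi>"] form_germ_differential[of P \<phi>]
      form_germ_differential[of P \<psi>] form_germ_differential[of P "\<phi> + \<psi>"]
  proof eventually_elim
    case (elim w)
    have "\<forall>\<^sub>F v in nhds w. v \<in> ball (germ_pt P) r - {germ_pt P}"
      using elim(1) by (intro eventually_nhds_in_open) auto
    then have "\<forall>\<^sub>F v in nhds w. fun_germ P (\<phi> + \<psi>) v = fun_germ P \<phi> v + fun_germ P \<psi> v"
      by eventually_elim (rule r(2))
    then have "deriv (fun_germ P (\<phi> + \<psi>)) w = deriv (\<lambda>v. fun_germ P \<phi> v + fun_germ P \<psi> v) w"
      by (intro deriv_cong_ev refl)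
    with elim show ?case
      by (simp add: analytic_on_imp_differentiable_at)
  qed
qed

lemma fun_regular_on_subset: "fun_regular_on S \<phi> \<Longrightarrow> T \<subseteq> S \<Longrightarrow> fun_regular_on T \<phi>"
  by (auto simp: fun_regular_on_iff)

lemma form_regular_on_subset: "form_regular_on S \<phi> \<Longrightarrow> T \<subseteq> S \<Longrightarrow> form_regular_on T \<phi>"
  by (auto simp: form_regular_on_iff)

lemma fun_regular_on_add:
  assumes "fun_regular_on S \<phi>" "fun_regular_on S \<psi>"
  shows "fun_regular_on S (\<phi> + \<psi>)"
  unfolding fun_regular_on_iff
proof
  fix P assume "P \<in> S"
  with assms have "(\<lambda>w. fun_germ P \<phi> w + fun_germ P \<psi> w) analytic_on {germ_pt P}"
    unfolding fun_regular_on_iff by (intro analytic_intros) auto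
  then show "fun_germ P (\<phi> + \<psi>) analytic_on {germ_pt P}"
    by (rule nicely_meromorphic_transform_analytic[OF fun_germ_nice _ fun_germ_add])
qed

lemma form_regular_on_add:
  assumes "form_regular_on S \<alpha>" "form_regular_on S \<beta>"
  shows "form_regular_on S (\<alpha> + \<beta>)"
  unfolding form_regular_on_iff
proof
  fix P assume "P \<in> S"
  with assms have "(\<lambda>w. form_germ P \<alpha> w + form_germ P \<beta> w) analytic_on {germ_pt P}"
    unfolding form_regular_on_iff by (intro analytic_intros) auto
  then show "form_germ P (\<alpha> + \<beta>) analytic_on {germ_pt P}"
    by (rule nicely_meromorphic_transform_analytic[OF form_germ_nice _ form_germ_add])
qed

lemma form_regular_on_scale:
  assumes "form_regular_on S \<alpha>"
  shows "form_regular_on S (mform_scale c \<alpha>)"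
  unfolding form_regular_on_iff
proof
  fix P assume "P \<in> S"
  with assms have "(\<lambda>w. c * form_germ P \<alpha> w) analytic_on {germ_pt P}"
    unfolding form_regular_on_iff by (intro analytic_intros) auto
  then show "form_germ P (mform_scale c \<alpha>) analytic_on {germ_pt P}"
    by (rule nicely_meromorphic_transform_analytic[OF form_germ_nice _ form_germ_scale])
qed

lemma form_regular_on_times:
  assumes "fun_regular_on S \<phi>" "form_regular_on S \<alpha>"
  shows "form_regular_on S (\<phi> \<cdot> \<alpha>)"
  unfolding form_regular_on_iff
proof
  fix P assume "P \<in> S"
  with assms have "(\<lambda>w. fun_germ P \<phi> w * form_germ P \<alpha> w) analytic_on {germ_pt P}"
    unfolding fun_regular_on_iff form_regular_on_iff by (intro analytic_intros) auto
  then show "form_germ P (\<phi> \<cdot> \<alpha>) analytic_on {germ_pt P}"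
    by (rule nicely_meromorphic_transform_analytic[OF form_germ_nice _ form_germ_times])
qed

lemma form_regular_on_differential:
  assumes "fun_regular_on S \<phi>"
  shows "form_regular_on S (differential \<phi>)"
  unfolding form_regular_on_iff
proof
  fix P assume "P \<in> S"
  with assms have "deriv (fun_germ P \<phi>) analytic_on {germ_pt P}"
    unfolding fun_regular_on_iff by (intro analytic_intros) auto
  then show "form_germ P (differential \<phi>) analytic_on {germ_pt P}"
    by (rule nicely_meromorphic_transform_analytic[OF form_germ_nice _ form_germ_differential])
qed

section \<open>Residues\<close>

lemma residue_laurent:
  "f meromorphic_on {z} \<Longrightarrow> residue f z = fls_residue (laurent_expansion f z)"
  by (intro has_laurent_expansion_residue meromorphic_on_imp_has_laurent_expansion) auto

lemma residue_add_meromorphic: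
  assumes "f meromorphic_on {z}" "g meromorphic_on {z}"
  shows "residue (\<lambda>w. f w + g w) z = residue f z + residue g z"
proof -
  have "(\<lambda>w. f (z + w) + g (z + w)) has_laurent_expansion laurent_expansion f z + laurent_expansion g z"
    using assms by (intro has_laurent_expansion_add meromorphic_on_imp_has_laurent_expansion) auto
  then show ?thesis
    using assms by (simp add: residue_laurent has_laurent_expansion_residue)
qed

lemma residue_cmult_meromorphic:
  assumes "f meromorphic_on {z}"
  shows "residue (\<lambda>w. c * f w) z = c * residue f z"
proof -
  have "(\<lambda>w. c * f (z + w)) has_laurent_expansion fls_const c * laurent_expansion f z"
    using assms by (intro laurent_expansion_intros meromorphic_on_imp_has_laurent_expansion) auto
  then show ?thesis
    using assms by (simp add: residue_laurent has_laurent_expansion_residue)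
qed

lemma Res_add: "Res P (\<alpha> + \<beta>) = Res P \<alpha> + Res P \<beta>"
  unfolding Res_germ residue_add_meromorphic[OF form_germ_meromorphic form_germ_meromorphic, symmetric]
  by (intro residue_cong form_germ_add refl)

lemma Res_scale: "Res P (mform_scale c \<alpha>) = c * Res P \<alpha>"
  unfolding Res_germ residue_cmult_meromorphic[OF form_germ_meromorphic, symmetric]
  by (intro residue_cong form_germ_scale refl)

lemma residue_analytic: "f analytic_on {z} \<Longrightarrow> residue f z = 0"
  by (auto simp: analytic_at intro: residue_holo)

lemma Res_regular: "form_regular_on {P} \<alpha> \<Longrightarrow> Res P \<alpha> = 0"
  by (simp add: form_regular_on_iff Res_germ residue_analytic)

text \<open>The primitive may have an essential singularity at \<open>z\<close>.\<close>

lemma residue_primitive: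
  assumes "open S" "z \<in> S" "\<And>w. w \<in> S - {z} \<Longrightarrow> (F has_field_derivative f w) (at w)"
  shows "residue f z = 0"
proof -
  obtain r where r: "r > 0" "cball z r \<subseteq> S"
    using assms(1,2) by (auto simp: open_contains_cball)
  have F: "F holomorphic_on S - {z}"
    using assms(3) by (meson field_differentiable_at_within field_differentiable_def holomorphic_on_def)
  have "deriv F holomorphic_on S - {z}"
    using F assms(1) by (intro holomorphic_deriv) auto
  moreover have "deriv F w = f w" if "w \<in> S - {z}" for w
    using assms(3)[OF that] by (rule DERIV_imp_deriv)
  ultimately have "f holomorphic_on S - {z}"
    by (metis holomorphic_transform)
  then have "(f has_contour_integral 2 * of_real pi * \<i> * residue f z) (circlepath z r)"
    using base_residue[OF assms(1,2) r(1) _ r(2)] by simp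
  moreover have "sphere z r \<subseteq> S - {z}"
    using r by auto
  then have "(f has_contour_integral F (pathfinish (circlepath z r)) - F (pathstart (circlepath z r))) (circlepath z r)"
    using r(1) by (intro contour_integral_primitive[of "S - {z}"])
      (auto intro: assms(3) has_field_derivative_at_within)
  ultimately show ?thesis
    by (auto dest: has_contour_integral_unique)
qed

lemma residue_deriv:
  assumes "isolated_singularity_at f z"
  shows "residue (deriv f) z = 0"
proof -
  obtain r where r: "r > 0" "f analytic_on ball z r - {z}"
    using assms by (auto simp: isolated_singularity_at_def)
  show ?thesis
  proof (rule residue_primitive)
    show "(f has_field_derivative deriv f w) (at w)" if "w \<in> ball z r - {z}" for w
      using r(2) that analytic_on_analytic_at analytic_on_imp_differentiable_at
        DERIV_deriv_iff_field_differentiable by blast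
  qed (use r(1) in auto)
qed

lemma Res_differential: "Res P (differential \<phi>) = 0"
proof -
  have "residue (form_germ P (differential \<phi>)) (germ_pt P) = residue (deriv (fun_germ P \<phi>)) (germ_pt P)"
    by (intro residue_cong form_germ_differential refl)
  then show ?thesis
    using fun_germ_meromorphic[of P \<phi>] by (simp add: Res_germ residue_deriv meromorphic_at_iff)
qed

lemma differential_in_K_space: "differential \<phi> \<in> K_space"
  by (simp add: K_space_def Res_differential)

text \<open>Integration by parts: \<open>\<phi> d\<psi> + \<psi> d\<phi>\<close> is locally the derivative of \<open>\<phi> \<psi>\<close>.\<close>

lemma Res_by_parts: "Res P (\<phi> \<cdot> differential \<psi>) = - Res P (\<psi> \<cdot> differential \<phi>)"
proof -
  have "residue (form_germ P (\<phi> \<cdot> differential \<psi> + \<psi> \<cdot> differential \<phi>)) (germ_pt P)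
      = residue (deriv (\<lambda>w. fun_germ P \<phi> w * fun_germ P \<psi> w)) (germ_pt P)"
    using eventually_fun_germ_analytic[of P \<phi>] eventually_fun_germ_analytic[of P \<psi>]
      form_germ_times[of P \<phi> "differential \<psi>"] form_germ_times[of P \<psi> "differential \<phi>"]
      form_germ_differential[of P \<phi>] form_germ_differential[of P \<psi>]
      form_germ_add[of P "\<phi> \<cdot> differential \<psi>" "\<psi> \<cdot> differential \<phi>"]
    by (intro residue_cong refl, eventually_elim) (simp add: analytic_on_imp_differentiable_at)
  also have "\<dots> = 0"
    using meromorphic_on_mult[OF fun_germ_meromorphic[of P \<phi>] fun_germ_meromorphic[of P \<psi>]]
    by (intro residue_deriv) (simp add: meromorphic_at_iff)
  finally show ?thesis
    unfolding Res_germ[symmetric] Res_add by (simp add: eq_neg_iff_add_eq_0)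
qed

section \<open>The commutator of two field operators\<close>

text \<open>The common shape of the three families of operators, for a functional \<open>L\<close> on forms and a
  decomposition \<open>\<phi> = \<phi>\<^sub>1 + \<phi>\<^sub>2\<close> in which only \<open>\<phi>\<^sub>1\<close> creates.\<close>

definition field_op ::
    "mform set \<Rightarrow> (mform \<Rightarrow> complex) \<Rightarrow> mfun \<Rightarrow> mfun \<Rightarrow> sym_poly set \<Rightarrow> sym_poly set" where
  "field_op V L \<phi>1 \<phi>2 w =
     (annihilate V (\<lambda>\<alpha>. L (\<phi>1 \<cdot> \<alpha>)) w \<oplus>\<^bsub>Sym V\<^esub> create V (differential \<phi>1) w)
       \<oplus>\<^bsub>Sym V\<^esub> annihilate V (\<lambda>\<alpha>. L (\<phi>2 \<cdot> \<alpha>)) w"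

text \<open>A functional \<open>L\<close>, linear on the set \<open>M\<close> of forms and vanishing on the exact forms
  \<open>\<phi> d\<psi> + \<psi> d\<phi>\<close>, for functions taken from a set \<open>R\<close>; the symmetric algebra is that of \<open>V\<close>.  In the
  instances \<open>L\<close> is, up to a constant factor, a residue, with no restriction on forms or functions, or
  a boundary integral, with forms and functions regular along the boundary.\<close>

locale residue_functional =
  fixes V M :: "mform set" and R :: "mfun set" and L :: "mform \<Rightarrow> complex"
  assumes subspace: "mform.subspace V"
    and R_add: "\<phi> \<in> R \<Longrightarrow> \<psi> \<in> R \<Longrightarrow> \<phi> + \<psi> \<in> R"
    and differential_V: "\<phi> \<in> R \<Longrightarrow> differential \<phi> \<in> V"
    and times_M: "\<phi> \<in> R \<Longrightarrow> \<alpha> \<in> V \<Longrightarrow> \<phi> \<cdot> \<alpha> \<in> M"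
    and L_add: "\<alpha> \<in> M \<Longrightarrow> \<beta> \<in> M \<Longrightarrow> L (\<alpha> + \<beta>) = L \<alpha> + L \<beta>"
    and L_scale: "\<alpha> \<in> M \<Longrightarrow> L (mform_scale c \<alpha>) = c * L \<alpha>"
    and by_parts: "\<phi> \<in> R \<Longrightarrow> \<psi> \<in> R \<Longrightarrow> L (\<phi> \<cdot> differential \<psi>) = - L (\<psi> \<cdot> differential \<phi>)"
begin

lemma annihilate_class:
  assumes "\<phi> \<in> R" "p \<in> carrier (free_alg V)"
  shows "annihilate V (\<lambda>\<alpha>. L (\<phi> \<cdot> \<alpha>)) (sym_class V p)
    = sym_class V (annihilate_poly (\<lambda>\<alpha>. L (\<phi> \<cdot> \<alpha>)) p)"
  by (rule annihilate_sym_class[OF subspace _ _ assms(2)])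
    (simp_all add: fun_times_form_add_right fun_times_form_scale L_add L_scale times_M assms(1))

lemma field_op_class:
  assumes "\<phi>1 \<in> R" "\<phi>2 \<in> R" "p \<in> carrier (free_alg V)"
  shows "field_op V L \<phi>1 \<phi>2 (sym_class V p)
    = sym_class V (field_poly (\<lambda>\<alpha>. L (\<phi>1 \<cdot> \<alpha>) + L (\<phi>2 \<cdot> \<alpha>)) (differential \<phi>1) p)"
proof -
  have "var (differential \<phi>1) \<in> carrier (free_alg V)"
    using differential_V[OF assms(1)] by (auto simp: free_alg_def)
  with assms show ?thesis
    unfolding field_op_def create_def field_poly_def annihilate_poly_add_functional
    by (simp add: annihilate_class sym_class_add[OF subspace] sym_class_mult[OF subspace]
        free_alg_closed annihilate_poly_carrier add_ac)
qed

lemma field_op_commutator: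
  assumes R: "\<phi>1 \<in> R" "\<phi>2 \<in> R" "\<psi>1 \<in> R" "\<psi>2 \<in> R"
    and null: "L (\<phi>1 \<cdot> differential \<psi>1) = 0" "L (\<phi>2 \<cdot> differential \<psi>2) = 0"
    and w: "w \<in> carrier (Sym V)"
  shows "field_op V L \<phi>1 \<phi>2 (field_op V L \<psi>1 \<psi>2 w)
      \<ominus>\<^bsub>Sym V\<^esub> field_op V L \<psi>1 \<psi>2 (field_op V L \<phi>1 \<phi>2 w)
    = sym_scale V (L ((\<phi>1 + \<phi>2) \<cdot> differential (\<psi>1 + \<psi>2))) w"
proof -
  obtain p where p: "p \<in> carrier (free_alg V)" "w = sym_class V p"
    using w by (rule Sym_carrierE[OF subspace])
  define A where "A = (\<lambda>\<alpha>. L (\<phi>1 \<cdot> \<alpha>) + L (\<phi>2 \<cdot> \<alpha>))"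
  define B where "B = (\<lambda>\<alpha>. L (\<psi>1 \<cdot> \<alpha>) + L (\<psi>2 \<cdot> \<alpha>))"
  have "L ((\<phi>1 + \<phi>2) \<cdot> differential (\<psi>1 + \<psi>2))
      = L (\<phi>1 \<cdot> differential \<psi>1) + L (\<phi>2 \<cdot> differential \<psi>1)
        + (L (\<phi>1 \<cdot> differential \<psi>2) + L (\<phi>2 \<cdot> differential \<psi>2))"
    using R by (simp add: differential_add fun_times_form_add_right L_add times_M R_add
        differential_V mform.subspace_add[OF subspace])
      (simp add: fun_times_form_add_left L_add times_M differential_V)
  \<comment> \<open>By antisymmetry, \<open>\<langle>\<phi>\<^sub>1, \<psi>\<^sub>2\<rangle> = - \<langle>\<psi>\<^sub>2, \<phi>\<^sub>1\<rangle>\<close>, and \<open>\<langle>\<psi>\<^sub>1, \<phi>\<^sub>1\<rangle> = 0\<close>.\<close>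
  also have "\<dots> = A (differential \<psi>1) - B (differential \<phi>1)"
    using by_parts[OF R(1,3)] by_parts[OF R(1,4)] null by (simp add: A_def B_def)
  finally have L: "L ((\<phi>1 + \<phi>2) \<cdot> differential (\<psi>1 + \<psi>2)) = A (differential \<psi>1) - B (differential \<phi>1)" .
  have carr: "field_poly A (differential \<phi>1) q \<in> carrier (free_alg V)"
    "field_poly B (differential \<psi>1) q \<in> carrier (free_alg V)" if "q \<in> carrier (free_alg V)" for q
    using that R by (auto intro!: field_poly_carrier differential_V)
  show ?thesis
    unfolding L sym_scale_def p(2)
    by (simp add: field_op_class R p(1) carr sym_class_minus[OF subspace] field_poly_commutator
        sym_class_mult[OF subspace] const_carrier flip: A_def B_def)
qed

end

section \<open>Splitting off poles\<close>

text \<open>A Taylor expansion of \<open>h\<close> to order \<open>n\<close>, divided by \<open>w\<^sup>n\<close>.\<close>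

lemma exists_polar_polynomial_power:
  fixes h :: "complex \<Rightarrow> complex"
  assumes "h analytic_on {0}"
  shows "\<exists>p r. r analytic_on {0} \<and> (\<forall>\<^sub>F w in at 0. h w / w ^ n = poly p (1 / w) + r w)"
  using assms
proof (induction n arbitrary: h)
  case 0
  then show ?case by (intro exI[of _ 0] exI[of _ h]) auto
next
  case (Suc n)
  let ?q = "\<lambda>w. (h w - h 0) / w"
  have mero: "?q meromorphic_on {0}"
    using analytic_on_imp_meromorphic_on[OF Suc.prems] by (intro meromorphic_intros)
  have "(h has_field_derivative deriv h 0) (at 0)"
    using Suc.prems by (simp add: analytic_on_imp_differentiable_at DERIV_deriv_iff_field_differentiable)
  then have "?q \<midarrow>0\<rightarrow> deriv h 0"
    by (simp add: has_field_derivative_iff)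
  then have "remove_sings ?q analytic_on {0}"
    using mero by (intro remove_sings_analytic_at) (simp_all add: meromorphic_at_iff)
  from Suc.IH[OF this] obtain p r where pr: "r analytic_on {0}"
    "\<forall>\<^sub>F w in at 0. remove_sings ?q w / w ^ n = poly p (1 / w) + r w" by blast
  have "\<forall>\<^sub>F w in at 0. h w / w ^ Suc n = poly (p + monom (h 0) (Suc n)) (1 / w) + r w"
    using pr(2) eventually_remove_sings_eq_meromorphic[OF mero] eventually_nonzero_at_0
  proof eventually_elim
    case (elim w)
    have "h w / w ^ Suc n = ?q w / w ^ n + h 0 * (1 / w) ^ Suc n"
      using elim(3) by (simp add: field_simps)
    then show ?case
      using elim by (simp add: poly_monom)
  qed
  with pr(1) show ?case by blast
qed

lemma exists_polar_polynomial:
  assumes "f meromorphic_on {z}"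
  shows "\<exists>p r. r analytic_on {z} \<and> (\<forall>\<^sub>F w in at z. f w = poly p (1 / (w - z)) + r w)"
proof (cases "is_pole f z")
  case False
  have "remove_sings f nicely_meromorphic_on {z}"
    using assms by (rule remove_sings_nicely_meromorphic)
  moreover have "\<not> is_pole (remove_sings f) z"
    using False assms by (simp add: meromorphic_at_iff)
  ultimately have "remove_sings f analytic_on {z}"
    by (simp add: nicely_meromorphic_analytic_iff)
  moreover have "\<forall>\<^sub>F w in at z. f w = poly 0 (1 / (w - z)) + remove_sings f w"
    using eventually_remove_sings_eq_meromorphic[OF assms] by eventually_elim simp
  ultimately show ?thesis by blast
next
  case True
  obtain r where r: "r > 0" "f analytic_on ball z r - {z}"
    using assms by (auto simp: meromorphic_at_iff isolated_singularity_at_def)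
  define n where "n = nat (- zorder f z)"
  define g where "g = zor_poly f z"
  from r(2) have "f holomorphic_on ball z r - {z}" by (rule analytic_imp_holomorphic)
  from zorder_exist_pole[OF this _ _ True] r(1)
  obtain s where s: "s > 0" "g holomorphic_on cball z s"
    "\<And>w. w \<in> cball z s - {z} \<Longrightarrow> f w = g w / (w - z) ^ n"
    by (auto simp: g_def n_def)
  have "g analytic_on {z}"
    using s(1,2) by (auto simp: analytic_at intro!: exI[of _ "ball z s"] holomorphic_on_subset[OF s(2)])
  then have "(g \<circ> (\<lambda>w. w + z)) analytic_on {0}"
    by (intro analytic_on_compose) (auto intro!: analytic_intros)
  then have "(\<lambda>w. g (w + z)) analytic_on {0}"
    by (simp add: o_def)
  from exists_polar_polynomial_power[OF this, of n] obtain p q where pq: "q analytic_on {0}"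
    "\<forall>\<^sub>F w in at 0. g (w + z) / w ^ n = poly p (1 / w) + q w" by blast
  have "(q \<circ> (\<lambda>w. w - z)) analytic_on {z}"
    using pq(1) by (intro analytic_on_compose) (auto intro!: analytic_intros)
  moreover have "\<forall>\<^sub>F w in at 0. w \<in> ball 0 s - {0}"
    using s(1) by (intro eventually_at_in_open) auto
  with pq(2) have "\<forall>\<^sub>F w in at 0. f (w + z) = poly p (1 / (w + z - z)) + (q \<circ> (\<lambda>w. w - z)) (w + z)"
    by eventually_elim (simp add: s(3) dist_norm)
  then have "\<forall>\<^sub>F w in at z. f w = poly p (1 / (w - z)) + (q \<circ> (\<lambda>w. w - z)) w"
    by (subst eventually_at_to_0)
  ultimately show ?thesis by blast
qed

lemma mfun_of_meromorphic:
  assumes "f meromorphic_on UNIV" "(\<lambda>w. f (1 / w)) meromorphic_on {0}"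
  obtains \<eta> where "mf_val \<eta> = remove_sings f"
  using assms Abs_mfun_inverse[of "remove_sings f"]
  by (auto intro: remove_sings_nicely_UNIV remove_sings_inverse_meromorphic)

lemma fun_regular_on_iff_singletons: "fun_regular_on S \<phi> \<longleftrightarrow> (\<forall>P\<in>S. fun_regular_on {P} \<phi>)"
  by (auto simp: fun_regular_on_def)

text \<open>Every function is, up to one regular at \<open>P\<close>, a function without poles other than \<open>P\<close>.\<close>

lemma exists_polar_part:
  obtains \<eta> \<rho> where "\<phi> = \<eta> + \<rho>" "fun_regular_on (- {P}) \<eta>" "fun_regular_on {P} \<rho>"
proof -
  obtain p r where r: "r analytic_on {germ_pt P}"
    "\<forall>\<^sub>F w in at (germ_pt P). fun_germ P \<phi> w = poly p (1 / (w - germ_pt P)) + r w"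
    using exists_polar_polynomial[OF fun_germ_meromorphic] by blast
  have "\<exists>\<eta>. fun_regular_on (- {P}) \<eta> \<and>
      (\<forall>\<^sub>F w in at (germ_pt P). fun_germ P \<eta> w = poly p (1 / (w - germ_pt P)))"
  proof (cases P)
    case (Fin a)
    let ?f = "\<lambda>z. poly p (1 / (z - a))"
    let ?h = "\<lambda>w. poly p (w / (1 - a * w))"
    have mero: "?f meromorphic_on UNIV"
      unfolding poly_altdef by (intro meromorphic_intros)
    have ana: "?h analytic_on {0}"
      unfolding poly_altdef by (intro analytic_intros) auto
    have ev: "\<forall>\<^sub>F w in at 0. ?f (1 / w) = ?h w"
      using eventually_nonzero_at_0
    proof eventually_elim
      case (elim w)
      then have "1 / (1 / w - a) = w / (1 - a * w)" by (simp add: field_simps)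
      then show ?case by simp
    qed
    have mero2: "(\<lambda>w. ?f (1 / w)) meromorphic_on {0}"
      using analytic_on_imp_meromorphic_on[OF ana] ev
      by (subst meromorphic_on_cong[where g = ?h and B = "{0}"]) auto
    obtain \<eta> where \<eta>: "mf_val \<eta> = remove_sings ?f"
      using mfun_of_meromorphic[OF mero mero2] .
    have "fun_regular_on (- {P}) \<eta>"
      unfolding fun_regular_on_iff
    proof
      fix Q assume Q: "Q \<in> - {P}"
      show "fun_germ Q \<eta> analytic_on {germ_pt Q}"
      proof (cases Q)
        case (Fin z)
        with Q \<open>P = Fin a\<close> have "?f analytic_on {z}"
          unfolding poly_altdef by (intro analytic_intros) auto
        then show ?thesis
          using Fin \<eta> by (simp add: remove_sings_analytic_on)
      next
        case Infty
        have "\<forall>\<^sub>F w in at 0. fun_germ Infty \<eta> w = ?h w"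
          using eventually_fun_inf[of \<eta>] eventually_remove_sings_at_inverse[OF mero2] ev
          by eventually_elim (simp only: \<eta>)
        then show ?thesis
          unfolding Infty germ_simps(2)
          by (rule nicely_meromorphic_transform_analytic[OF
                fun_germ_nice[of Infty \<eta>, unfolded germ_simps(2)] ana])
      qed
    qed
    moreover have "\<forall>\<^sub>F w in at a. remove_sings ?f w = ?f w"
      using mero by (intro eventually_remove_sings_eq_meromorphic) (auto intro: meromorphic_on_subset)
    ultimately show ?thesis
      using Fin \<eta> by auto
  next
    case Infty
    have ana: "poly p analytic_on UNIV"
      unfolding poly_altdef by (intro analytic_intros)
    have "(\<lambda>w. poly p (1 / w)) meromorphic_on {0}"
      unfolding poly_altdef by (intro meromorphic_intros)
    then obtain \<eta> where \<eta>: "mf_val \<eta> = remove_sings (poly p)"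
      using mfun_of_meromorphic[OF analytic_on_imp_meromorphic_on[OF ana]] by blast
    then have \<eta>': "mf_val \<eta> = poly p"
      using ana by (simp add: remove_sings_nicely_id analytic_on_imp_nicely_meromorphic_on)
    have "fun_regular_on (- {P}) \<eta>"
      unfolding fun_regular_on_iff
    proof
      fix Q assume "Q \<in> - {P}"
      then show "fun_germ Q \<eta> analytic_on {germ_pt Q}"
        using Infty ana \<eta>' by (cases Q) (auto intro: analytic_on_subset)
    qed
    then show ?thesis
      using eventually_fun_inf[of \<eta>] by (intro exI[of _ \<eta>]) (simp add: Infty \<eta>')
  qed
  then obtain \<eta> where \<eta>: "fun_regular_on (- {P}) \<eta>"
    "\<forall>\<^sub>F w in at (germ_pt P). fun_germ P \<eta> w = poly p (1 / (w - germ_pt P))" by blast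
  have \<phi>: "\<phi> = \<eta> + (\<phi> - \<eta>)" by simp
  have "\<forall>\<^sub>F w in at (germ_pt P). fun_germ P (\<phi> - \<eta>) w = r w"
    using fun_germ_add[of P \<eta> "\<phi> - \<eta>", folded \<phi>] r(2) \<eta>(2) by eventually_elim simp
  then have "fun_germ P (\<phi> - \<eta>) analytic_on {germ_pt P}"
    using r(1) by (intro nicely_meromorphic_transform_analytic[OF fun_germ_nice])
  with \<eta>(1) \<phi> show ?thesis
    by (intro that[of \<eta> "\<phi> - \<eta>"]) (auto simp: fun_regular_on_iff)
qed

text \<open>The poles in the plane are bounded and do not accumulate.\<close>

lemma finite_poles: "finite {P. \<not> fun_regular_on {P} \<phi>}"
proof -
  let ?A = "{z. \<not> mf_val \<phi> analytic_on {z}}"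
  obtain d where d: "d > 0" "\<And>w. w \<noteq> 0 \<Longrightarrow> norm w < d \<Longrightarrow> mf_val \<phi> analytic_on {1 / w}"
    using eventually_remove_sings_inverse[OF mfun_props(3)[of \<phi>]] by (auto simp: eventually_at)
  have "norm z \<le> 1 / d" if "z \<in> ?A" for z
  proof (rule ccontr)
    assume "\<not> norm z \<le> 1 / d"
    then have "1 / d < norm z" by simp
    moreover from this have "0 < norm z" using d(1) by (smt (verit) divide_pos_pos)
    ultimately have "norm (1 / z) < d" "z \<noteq> 0"
      using d(1) by (auto simp: norm_divide field_simps)
    from d(2)[of "1 / z"] this that show False by simp
  qed
  then have "bounded ?A" by (auto intro: boundedI)
  have "finite ?A"
  proof (rule ccontr)
    assume "infinite ?A"
    then obtain l where "l islimpt ?A"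
      using \<open>bounded ?A\<close> bounded_infinite_imp_islimpt by blast
    moreover have "\<forall>\<^sub>F w in at l. mf_val \<phi> analytic_on {w}"
      by (intro eventually_analytic_at mfun_props)
    ultimately show False
      by (simp add: islimpt_conv_frequently_at frequently_def)
  qed
  moreover have "{P. \<not> fun_regular_on {P} \<phi>} \<subseteq> insert Infty (Fin ` ?A)"
  proof
    fix P assume "P \<in> {P. \<not> fun_regular_on {P} \<phi>}"
    then show "P \<in> insert Infty (Fin ` ?A)" by (cases P) (auto simp: fun_regular_on_iff)
  qed
  ultimately show ?thesis by (meson finite.insertI finite_imageI finite_subset)
qed

lemma fun_regular_on_uminus: "fun_regular_on S (- \<phi>) \<longleftrightarrow> fun_regular_on S \<phi>"
  by (simp add: fun_regular_on_def uminus_mfun.rep_eq split: proj_line.split)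

lemma fun_regular_on_0: "fun_regular_on S 0"
proof -
  have "mf_val 0 = (\<lambda>_. 0)" by (rule zero_mfun.rep_eq)
  then show ?thesis by (auto simp: fun_regular_on_def split: proj_line.split)
qed

text \<open>The decompositions that enter the operators: the poles of \<open>\<phi>\<close> outside \<open>S\<close> go to \<open>\<phi>\<^sub>1\<close>, the others,
  which are outside \<open>T\<close>, to \<open>\<phi>\<^sub>2\<close>.\<close>

lemma exists_split:
  assumes "fun_regular_on (S \<inter> T) \<phi>"
  shows "\<exists>\<phi>1 \<phi>2. \<phi> = \<phi>1 + \<phi>2 \<and> fun_regular_on S \<phi>1 \<and> fun_regular_on T \<phi>2"
proof -
  have "\<exists>\<phi>1 \<phi>2. \<phi> = \<phi>1 + \<phi>2 \<and> fun_regular_on S \<phi>1 \<and> fun_regular_on T \<phi>2"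
    if "finite F" "F \<inter> (S \<inter> T) = {}" "fun_regular_on (- F) \<phi>" for F \<phi>
    using that
  proof (induction F arbitrary: \<phi> rule: finite_induct)
    case empty
    then show ?case
      by (intro exI[of _ \<phi>] exI[of _ 0]) (auto intro: fun_regular_on_subset fun_regular_on_0)
  next
    case (insert P F)
    obtain \<eta> \<rho> where \<eta>: "\<phi> = \<eta> + \<rho>" "fun_regular_on (- {P}) \<eta>" "fun_regular_on {P} \<rho>"
      by (rule exists_polar_part)
    have "\<rho> = \<phi> + - \<eta>" using \<eta>(1) by simp
    moreover have "fun_regular_on (- insert P F) (- \<eta>)"
      using \<eta>(2) by (auto simp: fun_regular_on_uminus intro: fun_regular_on_subset)
    ultimately have "fun_regular_on (- insert P F) \<rho>"
      using insert.prems(2) by (simp only: fun_regular_on_add)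
    with \<eta>(3) have "fun_regular_on (- F) \<rho>"
      by (subst fun_regular_on_iff_singletons) (metis ComplD ComplI insertE fun_regular_on_iff_singletons)
    with insert.IH[of \<rho>] insert.prems(1) obtain \<rho>1 \<rho>2
      where \<rho>: "\<rho> = \<rho>1 + \<rho>2" "fun_regular_on S \<rho>1" "fun_regular_on T \<rho>2" by auto
    show ?case
    proof (cases "P \<in> S")
      case True
      with insert.prems(1) have "T \<subseteq> - {P}" by auto
      with \<eta> \<rho> show ?thesis
        by (intro exI[of _ \<rho>1] exI[of _ "\<eta> + \<rho>2"])
          (auto simp: add_ac intro!: fun_regular_on_add intro: fun_regular_on_subset)
    next
      case False
      then have "S \<subseteq> - {P}" by auto
      with \<eta> \<rho> show ?thesis
        by (intro exI[of _ "\<eta> + \<rho>1"] exI[of _ \<rho>2])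
          (auto simp: add_ac intro!: fun_regular_on_add intro: fun_regular_on_subset)
    qed
  qed
  note * = this
  show ?thesis
    by (rule *[OF finite_poles[of \<phi>]])
      (use assms in \<open>auto simp: fun_regular_on_iff\<close>)
qed

lemma split_fun_props:
  assumes "fun_regular_on (S \<inter> T) \<phi>"
  obtains \<phi>1 \<phi>2 where "split_fun S T \<phi> = (\<phi>1, \<phi>2)" "\<phi> = \<phi>1 + \<phi>2"
    "fun_regular_on S \<phi>1" "fun_regular_on T \<phi>2"
proof -
  let ?P = "\<lambda>(\<phi>1, \<phi>2). \<phi> = \<phi>1 + \<phi>2 \<and> fun_regular_on S \<phi>1 \<and> fun_regular_on T \<phi>2"
  have "?P (split_fun S T \<phi>)"
    unfolding split_fun_def by (rule someI_ex) (use exists_split[OF assms] in auto)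
  then show ?thesis by (cases "split_fun S T \<phi>") (auto intro: that)
qed

section \<open>The chart in which a given point is moved to infinity\<close>

text \<open>The coordinate \<open>u = 1 / (z - a)\<close> covers the projective line without the point \<open>a\<close>;
  \<open>chart_form a \<alpha>\<close> is the coefficient of \<open>\<alpha>\<close> in this coordinate.  At infinity it equals the
  coefficient in the coordinate \<open>w = 1 / z\<close>, because \<open>dw / du = 1\<close> there.\<close>

definition chart_at :: "complex \<Rightarrow> complex \<Rightarrow> proj_line" where
  "chart_at a u = (if u = 0 then Infty else Fin (a + 1 / u))"

definition chart_form :: "complex \<Rightarrow> mform \<Rightarrow> complex \<Rightarrow> complex" where
  "chart_form a \<alpha> u = (if u = 0 then coeff_inf \<alpha> 0 else - coeff \<alpha> (a + 1 / u) / u\<^sup>2)"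

lemma chart_form_analytic:
  assumes "form_regular_on {chart_at a u} \<alpha>"
  shows "chart_form a \<alpha> analytic_on {u}"
proof (cases "u = 0")
  case False
  with assms have "coeff \<alpha> analytic_on {a + 1 / u}"
    by (simp add: form_regular_on_iff chart_at_def)
  moreover have "(\<lambda>u. a + 1 / u) analytic_on {u}"
    using False by (auto intro!: analytic_intros)
  ultimately have "(coeff \<alpha> \<circ> (\<lambda>u. a + 1 / u)) analytic_on {u}"
    by (intro analytic_on_compose_gen[where T = "{a + 1 / u}"]) auto
  then have h: "(\<lambda>u. - coeff \<alpha> (a + 1 / u) / u\<^sup>2) analytic_on {u}"
    using False by (auto intro!: analytic_intros simp: o_def)
  have "\<forall>\<^sub>F v in nhds u. v \<in> - {0}"
    using False by (intro eventually_nhds_in_open) auto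
  then have "\<forall>\<^sub>F v in nhds u. - coeff \<alpha> (a + 1 / v) / v\<^sup>2 = chart_form a \<alpha> v"
    by eventually_elim (simp add: chart_form_def)
  from analytic_at_cong[OF this refl] h show ?thesis by simp
next
  case True
  \<comment> \<open>The coordinate \<open>w = 1 / z\<close> in terms of \<open>u = 1 / (z - a)\<close>.\<close>
  let ?v = "\<lambda>u. u / (1 + a * u)"
  have v: "?v analytic_on {0}"
    by (auto intro!: analytic_intros)
  have "coeff_inf \<alpha> analytic_on {0}"
    using assms True by (simp add: form_regular_on_iff chart_at_def)
  with v have "(coeff_inf \<alpha> \<circ> ?v) analytic_on {0}"
    by (intro analytic_on_compose_gen[where T = "{0}"]) auto
  then have h: "(\<lambda>u. coeff_inf \<alpha> (?v u) / (1 + a * u)\<^sup>2) analytic_on {0}"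
    by (auto intro!: analytic_intros simp: o_def)
  have "((\<lambda>u. 1 + a * u) \<longlongrightarrow> 1 + a * 0) (nhds 0)"
    by (intro tendsto_intros filterlim_ident)
  then have "\<forall>\<^sub>F u in nhds 0. 1 + a * u \<noteq> 0"
    by (rule tendsto_imp_eventually_ne) simp
  then have nz: "\<forall>\<^sub>F u in at 0. 1 + a * u \<noteq> 0"
    by (simp add: eventually_nhds_conv_at)
  have "?v \<midarrow>0\<rightarrow> ?v 0"
    using analytic_at_imp_isCont[OF v] by (simp add: isCont_def)
  then have "filterlim ?v (at 0) (at 0)"
    using nz eventually_nonzero_at_0 by (auto simp: filterlim_at elim: eventually_elim2)
  from eventually_compose_filterlim[OF eventually_coeff_inf[of \<alpha>] this] nz eventually_nonzero_at_0
  have "\<forall>\<^sub>F u in at 0. coeff_inf \<alpha> (?v u) / (1 + a * u)\<^sup>2 = chart_form a \<alpha> u"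
  proof eventually_elim
    case (elim u)
    have "1 / ?v u = a + 1 / u" using elim by (simp add: field_simps)
    with elim show ?case by (simp add: chart_form_def power_divide)
  qed
  then have "\<forall>\<^sub>F u in nhds 0. coeff_inf \<alpha> (?v u) / (1 + a * u)\<^sup>2 = chart_form a \<alpha> u"
    by (simp add: eventually_nhds_conv_at chart_form_def)
  from analytic_at_cong[OF this refl] h True show ?thesis by simp
qed

lemma entire_primitive:
  assumes "\<And>z. g analytic_on {z}"
  obtains G where "\<And>z. (G has_field_derivative g z) (at z)"
proof -
  have "g holomorphic_on UNIV"
    using assms analytic_on_analytic_at analytic_imp_holomorphic by blast
  then show ?thesis
    using holomorphic_convex_primitive'[of UNIV g] that by auto
qed

text \<open>The residue theorem for a form with a single pole: in a coordinate in which the pole is at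
  infinity, the form has an entire coefficient, hence an entire primitive.\<close>

lemma Res_single_pole:
  assumes "form_regular_on (- {P}) \<alpha>"
  shows "Res P \<alpha> = 0"
proof (cases P)
  case (Fin a)
  have "chart_form a \<alpha> analytic_on {u}" for u
    by (rule chart_form_analytic, rule form_regular_on_subset[OF assms])
      (simp add: Fin chart_at_def)
  then obtain G where G: "\<And>u. (G has_field_derivative chart_form a \<alpha> u) (at u)"
    using entire_primitive[of "chart_form a \<alpha>"] by blast
  have "residue (coeff \<alpha>) a = 0"
  proof (rule residue_primitive[OF open_UNIV])
    fix z assume "z \<in> UNIV - {a}"
    then have z: "z - a \<noteq> 0" by simp
    have "((\<lambda>z. 1 / (z - a)) has_field_derivative - 1 / (z - a)\<^sup>2) (at z)"
      using z by (auto intro!: derivative_eq_intros simp: power2_eq_square)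
    from DERIV_chain2[OF G this]
    show "((\<lambda>z. G (1 / (z - a))) has_field_derivative coeff \<alpha> z) (at z)"
      using z by (simp add: chart_form_def power_divide)
  qed auto
  with Fin show ?thesis by (simp add: Res_def)
next
  case Infty
  have "coeff \<alpha> analytic_on {z}" for z
    using assms by (auto simp: form_regular_on_iff Infty dest: bspec[where x = "Fin z"])
  then obtain F where F: "\<And>z. (F has_field_derivative coeff \<alpha> z) (at z)"
    using entire_primitive[of "coeff \<alpha>"] by blast
  have "residue (coeff_inf \<alpha>) 0 = residue (\<lambda>w. - coeff \<alpha> (1 / w) / w\<^sup>2) 0"
    by (intro residue_cong eventually_coeff_inf refl)
  also have "\<dots> = 0"
  proof (rule residue_primitive[OF open_UNIV])
    fix w :: complex assume w: "w \<in> UNIV - {0}"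
    then have "((\<lambda>w. 1 / w) has_field_derivative - 1 / w\<^sup>2) (at w)"
      by (auto intro!: derivative_eq_intros simp: power2_eq_square)
    from DERIV_chain2[OF F this]
    show "((\<lambda>w. F (1 / w)) has_field_derivative - coeff \<alpha> (1 / w) / w\<^sup>2) (at w)"
      by simp
  qed auto
  finally show ?thesis by (simp add: Infty Res_def)
qed

section \<open>The operators attached to a point\<close>

lemma subspace_K_space: "mform.subspace K_space"
proof (rule mform.subspaceI)
  show "0 \<in> K_space"
    using Res_scale[of _ 0 0] by (simp add: K_space_def)
qed (simp_all add: K_space_def Res_add Res_scale)

lemma residue_functional_Res: "residue_functional K_space UNIV UNIV (\<lambda>\<alpha>. c * Res P \<alpha>)"
proof
  show "c * Res P (\<phi> \<cdot> differential \<psi>) = - (c * Res P (\<psi> \<cdot> differential \<phi>))" for \<phi> \<psi>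
    by (subst Res_by_parts) simp
qed (simp_all add: subspace_K_space differential_in_K_space Res_add Res_scale distrib_left)

lemma Res_regular_differential:
  assumes "fun_regular_on S \<phi>" "fun_regular_on S \<psi>" "S = {P} \<or> S = - {P}"
  shows "Res P (\<phi> \<cdot> differential \<psi>) = 0"
proof -
  have "form_regular_on S (\<phi> \<cdot> differential \<psi>)"
    using assms by (intro form_regular_on_times form_regular_on_differential)
  with assms(3) show ?thesis
    using Res_regular Res_single_pole by blast
qed

lemma Phi_right_commutator:
  assumes "w \<in> carrier W"
  shows "Phi_right P \<phi> (Phi_right P \<psi> w) \<ominus>\<^bsub>W\<^esub> Phi_right P \<psi> (Phi_right P \<phi> w)
    = sym_scale K_space (Res P (\<phi> \<cdot> differential \<psi>)) w"
proof -
  interpret residue_functional K_space UNIV UNIV "\<lambda>\<alpha>. 1 * Res P \<alpha>" by (rule residue_functional_Res)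
  have split: "fun_regular_on ({P} \<inter> - {P}) \<eta>" for \<eta> by (simp add: fun_regular_on_def)
  obtain \<phi>1 \<phi>2 where \<phi>: "split_fun {P} (- {P}) \<phi> = (\<phi>1, \<phi>2)" "\<phi> = \<phi>1 + \<phi>2"
    "fun_regular_on {P} \<phi>1" "fun_regular_on (- {P}) \<phi>2"
    by (rule split_fun_props[OF split])
  obtain \<psi>1 \<psi>2 where \<psi>: "split_fun {P} (- {P}) \<psi> = (\<psi>1, \<psi>2)" "\<psi> = \<psi>1 + \<psi>2"
    "fun_regular_on {P} \<psi>1" "fun_regular_on (- {P}) \<psi>2"
    by (rule split_fun_props[OF split])
  have op: "Phi_right P \<eta> = field_op K_space (\<lambda>\<alpha>. 1 * Res P \<alpha>) \<eta>1 \<eta>2"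
    if "split_fun {P} (- {P}) \<eta> = (\<eta>1, \<eta>2)" for \<eta> \<eta>1 \<eta>2
    by (rule ext) (simp add: Phi_right_def field_op_def that)
  have "1 * Res P (\<phi>1 \<cdot> differential \<psi>1) = 0" "1 * Res P (\<phi>2 \<cdot> differential \<psi>2) = 0"
    using Res_regular_differential[OF \<phi>(3) \<psi>(3)] Res_regular_differential[OF \<phi>(4) \<psi>(4)] by simp_all
  from field_op_commutator[OF _ _ _ _ this] assms show ?thesis
    unfolding op[OF \<phi>(1)] op[OF \<psi>(1)] W_def \<phi>(2)[symmetric] \<psi>(2)[symmetric] by simp
qed

lemma Phi_left_commutator:
  assumes "w \<in> carrier W"
  shows "Phi_left Q \<phi> (Phi_left Q \<psi> w) \<ominus>\<^bsub>W\<^esub> Phi_left Q \<psi> (Phi_left Q \<phi> w)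
    = sym_scale K_space (- Res Q (\<phi> \<cdot> differential \<psi>)) w"
proof -
  interpret residue_functional K_space UNIV UNIV "\<lambda>\<alpha>. - 1 * Res Q \<alpha>" by (rule residue_functional_Res)
  have split: "fun_regular_on (- {Q} \<inter> {Q}) \<eta>" for \<eta> by (simp add: fun_regular_on_def)
  obtain \<phi>1 \<phi>2 where \<phi>: "split_fun (- {Q}) {Q} \<phi> = (\<phi>1, \<phi>2)" "\<phi> = \<phi>1 + \<phi>2"
    "fun_regular_on (- {Q}) \<phi>1" "fun_regular_on {Q} \<phi>2"
    by (rule split_fun_props[OF split])
  obtain \<psi>1 \<psi>2 where \<psi>: "split_fun (- {Q}) {Q} \<psi> = (\<psi>1, \<psi>2)" "\<psi> = \<psi>1 + \<psi>2"
    "fun_regular_on (- {Q}) \<psi>1" "fun_regular_on {Q} \<psi>2"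
    by (rule split_fun_props[OF split])
  have op: "Phi_left Q \<eta> = field_op K_space (\<lambda>\<alpha>. - 1 * Res Q \<alpha>) \<eta>1 \<eta>2"
    if "split_fun (- {Q}) {Q} \<eta> = (\<eta>1, \<eta>2)" for \<eta> \<eta>1 \<eta>2
    by (rule ext) (simp add: Phi_left_def field_op_def that)
  have "- 1 * Res Q (\<phi>1 \<cdot> differential \<psi>1) = 0" "- 1 * Res Q (\<phi>2 \<cdot> differential \<psi>2) = 0"
    using Res_regular_differential[OF \<phi>(3) \<psi>(3)] Res_regular_differential[OF \<phi>(4) \<psi>(4)] by simp_all
  from field_op_commutator[OF _ _ _ _ this] assms show ?thesis
    unfolding op[OF \<phi>(1)] op[OF \<psi>(1)] W_def \<phi>(2)[symmetric] \<psi>(2)[symmetric] by simp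
qed

section \<open>The topology of the projective line in a chart\<close>

text \<open>The inverse of \<open>chart_at a\<close>; the value at the point \<open>a\<close> is the default \<open>1 / 0 = 0\<close>.\<close>

definition coord_at :: "complex \<Rightarrow> proj_line \<Rightarrow> complex" where
  "coord_at a P = (case P of Fin z \<Rightarrow> 1 / (z - a) | Infty \<Rightarrow> 0)"

lemma chart_at_coord_at: "P \<noteq> Fin a \<Longrightarrow> chart_at a (coord_at a P) = P"
  by (cases P) (auto simp: chart_at_def coord_at_def)

lemma coord_at_chart_at [simp]: "coord_at a (chart_at a u) = u"
  by (simp add: chart_at_def coord_at_def)

lemma chart_at_neq [simp]: "chart_at a u \<noteq> Fin a"
  by (simp add: chart_at_def)

lemma coord_at_chart_inf:
  assumes "1 - a * w \<noteq> 0"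
  shows "coord_at a (chart_inf w) = w / (1 - a * w)"
proof (cases "w = 0")
  case False
  then have "1 / w - a \<noteq> 0" using assms by (auto simp: field_simps)
  with False assms show ?thesis by (simp add: chart_inf_def coord_at_def field_simps)
qed (simp add: chart_inf_def coord_at_def)

lemma chart_inf_neq_iff: "chart_inf w \<noteq> Fin a \<longleftrightarrow> 1 - a * w \<noteq> 0"
  by (auto simp: chart_inf_def field_simps)

lemma open_proj_line_iff: "open U \<longleftrightarrow> open (Fin -` U) \<and> open (chart_inf -` U)"
  by (simp add: open_proj_line_def)

lemma open_preimage_on:
  fixes f :: "complex \<Rightarrow> complex"
  assumes "continuous_on X f" "open X" "open S"
  shows "open {x \<in> X. f x \<in> S}"
  using continuous_open_preimage[OF assms] by (simp add: vimage_def Int_def)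

lemma open_vimage_chart_at:
  assumes "open U"
  shows "open (chart_at a -` U)"
proof -
  \<comment> \<open>The two charts cover the line: the first covers all \<open>u \<noteq> 0\<close>, the second a neighbourhood of \<open>u = 0\<close>.\<close>
  have "chart_at a -` U = {u \<in> - {0}. a + 1 / u \<in> Fin -` U} \<union>
      {u \<in> {u. 1 + a * u \<noteq> 0}. u / (1 + a * u) \<in> chart_inf -` U}" (is "_ = ?A \<union> ?B")
  proof -
    have "chart_at a u = chart_inf (u / (1 + a * u))" if "1 + a * u \<noteq> 0" for u
      using that by (auto simp: chart_at_def chart_inf_def field_simps)
    moreover have "chart_at a u = Fin (a + 1 / u)" if "u \<noteq> 0" for u
      using that by (simp add: chart_at_def)
    moreover have "1 + a * u \<noteq> 0 \<or> u \<noteq> 0" for u by auto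
    ultimately show ?thesis by auto metis+
  qed
  moreover have U: "open (Fin -` U)" "open (chart_inf -` U)"
    using assms by (simp_all add: open_proj_line_iff)
  moreover have "open ?A"
    by (rule open_preimage_on[OF _ _ U(1)]) (auto intro!: continuous_intros)
  moreover have "open ?B"
    by (rule open_preimage_on[OF _ _ U(2)]) (auto intro!: continuous_intros open_Collect_neq)
  ultimately show ?thesis by auto
qed

lemma open_image_chart_at:
  assumes "open S"
  shows "open (chart_at a ` S)"
  unfolding open_proj_line_iff
proof
  have im: "P \<in> chart_at a ` S \<longleftrightarrow> P \<noteq> Fin a \<and> coord_at a P \<in> S" for P
    by (metis chart_at_coord_at chart_at_neq coord_at_chart_at image_iff)
  have "Fin z \<in> chart_at a ` S \<longleftrightarrow> z \<noteq> a \<and> 1 / (z - a) \<in> S" for z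
    unfolding im by (simp add: coord_at_def)
  then have "Fin -` chart_at a ` S = {z \<in> - {a}. 1 / (z - a) \<in> S}"
    by (simp add: vimage_def)
  also have "open \<dots>"
    using assms by (intro open_preimage_on continuous_intros) auto
  finally show "open (Fin -` chart_at a ` S)" .
  have "chart_inf w \<in> chart_at a ` S \<longleftrightarrow> 1 - a * w \<noteq> 0 \<and> w / (1 - a * w) \<in> S" for w
    unfolding im chart_inf_neq_iff by (metis coord_at_chart_inf)
  then have "chart_inf -` chart_at a ` S = {w \<in> {w. 1 - a * w \<noteq> 0}. w / (1 - a * w) \<in> S}"
    by (simp add: vimage_def)
  also have "open \<dots>"
    using assms by (intro open_preimage_on continuous_intros open_Collect_neq) auto
  finally show "open (chart_inf -` chart_at a ` S)" .
qed

lemma open_image_Fin: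
  assumes "open S"
  shows "open (Fin ` S)"
  unfolding open_proj_line_iff
proof
  have "Fin -` Fin ` S = S" by auto
  then show "open (Fin -` Fin ` S)" using assms by simp
  have "chart_inf -` Fin ` S = {w \<in> - {0}. 1 / w \<in> S}"
    by (auto simp: chart_inf_def split: if_splits)
  also have "open \<dots>"
    using assms by (intro open_preimage_on continuous_intros) auto
  finally show "open (chart_inf -` Fin ` S)" .
qed

lemma open_neq_Infty: "open (- {Infty})" and open_neq_0: "open (- {Fin 0})"
proof -
  have "- {Infty} = Fin ` UNIV" by (auto simp: image_iff) (metis proj_line.exhaust)
  then show "open (- {Infty})" using open_image_Fin[OF open_UNIV] by simp
  have "Fin -` (- {Fin 0}) = - {0}" "chart_inf -` (- {Fin 0}) = UNIV"
    by (auto simp: chart_inf_def split: if_splits)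
  then show "open (- {Fin 0})"
    unfolding open_proj_line_iff by (auto simp: open_Compl)
qed

lemma open_nonempty_Fin:
  assumes "open U" "U \<noteq> {}"
  obtains a where "Fin a \<in> U"
proof (cases "Infty \<in> U")
  case True
  then have "open (chart_inf -` U)" "0 \<in> chart_inf -` U"
    using assms(1) by (auto simp: open_proj_line_iff chart_inf_def)
  then have "\<forall>\<^sub>F w in nhds 0. w \<in> chart_inf -` U"
    by (rule eventually_nhds_in_open)
  then have "\<forall>\<^sub>F w in at 0. w \<in> chart_inf -` U"
    by (simp add: eventually_nhds_conv_at)
  with eventually_nonzero_at_0 have "\<forall>\<^sub>F w in at 0. Fin (1 / w) \<in> U"
    by eventually_elim (simp add: chart_inf_def)
  then show ?thesis
    using that eventually_happens'[of "at (0::complex)"] by auto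
next
  case False
  with assms(2) that show ?thesis by (metis all_not_in_conv proj_line.exhaust)
qed

section \<open>Integrals of forms over smooth loops\<close>

lemma smooth_onD:
  assumes "smooth_on T c" "open T"
  shows "t \<in> T \<Longrightarrow> (c has_vector_derivative vector_derivative c (at t)) (at t)"
    and "continuous_on T (\<lambda>t. vector_derivative c (at t))"
proof -
  obtain G where G: "\<And>t. t \<in> T \<Longrightarrow> G (0::nat) t = c t"
    "\<And>n t. t \<in> T \<Longrightarrow> (G n has_vector_derivative G (Suc n) t) (at t)"
    using assms(1) unfolding smooth_on_def by blast
  have d: "(c has_vector_derivative G 1 t) (at t)" if "t \<in> T" for t
    using has_vector_derivative_transform_within_open[OF G(2)[OF that, of 0] assms(2) that G(1)]
    by simp
  show "(c has_vector_derivative vector_derivative c (at t)) (at t)" if "t \<in> T"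
    unfolding vector_derivative_at[OF d[OF that]] by (rule d[OF that])
  have "continuous_on T (G 1)"
    by (meson G(2) continuous_at_imp_continuous_on has_vector_derivative_continuous)
  then show "continuous_on T (\<lambda>t. vector_derivative c (at t))"
    by (rule continuous_on_eq) (simp only: vector_derivative_at[OF d])
qed

text \<open>A simple closed smooth curve on the projective line, which may pass through infinity.\<close>

locale smooth_loop =
  fixes \<gamma> :: "real \<Rightarrow> proj_line"
  assumes smooth: "smooth_curve \<gamma>"
    and periodic: "\<gamma> (t + 1) = \<gamma> t"
    and inj: "inj_on \<gamma> {0..<1}"
begin

lemma open_finite: "open {t. \<gamma> t \<noteq> Infty}" and open_nonzero: "open {t. \<gamma> t \<noteq> Fin 0}"
proof -
  have "continuous_on UNIV \<gamma>" using smooth by (simp add: smooth_curve_def)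
  then have "open (\<gamma> -` (- {Infty}))" "open (\<gamma> -` (- {Fin 0}))"
    using open_neq_Infty open_neq_0 by (blast intro: open_vimage)+
  then show "open {t. \<gamma> t \<noteq> Infty}" "open {t. \<gamma> t \<noteq> Fin 0}"
    by (simp_all add: vimage_def)
qed

text \<open>Position and velocity in the two standard charts.\<close>

abbreviation "pos0 t \<equiv> coord0 (\<gamma> t)"
abbreviation "vel0 t \<equiv> vector_derivative (\<lambda>t. coord0 (\<gamma> t)) (at t)"
abbreviation "pos1 t \<equiv> coord_inf (\<gamma> t)"
abbreviation "vel1 t \<equiv> vector_derivative (\<lambda>t. coord_inf (\<gamma> t)) (at t)"

lemma coord_derivative:
  "\<gamma> t \<noteq> Infty \<Longrightarrow> (pos0 has_vector_derivative vel0 t) (at t)"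
  "\<gamma> t \<noteq> Fin 0 \<Longrightarrow> (pos1 has_vector_derivative vel1 t) (at t)"
  "continuous_on {t. \<gamma> t \<noteq> Infty} vel0" "continuous_on {t. \<gamma> t \<noteq> Fin 0} vel1"
  using smooth smooth_onD[OF _ open_finite] smooth_onD[OF _ open_nonzero]
  by (auto simp: smooth_curve_def)

lemma coord_continuous:
  "continuous_on {t. \<gamma> t \<noteq> Infty} pos0" "continuous_on {t. \<gamma> t \<noteq> Fin 0} pos1"
  by (auto intro!: continuous_at_imp_continuous_on has_vector_derivative_continuous coord_derivative)

lemma periodic_int: "\<gamma> (t + of_int n) = \<gamma> t"
proof (induction n rule: int_induct[where k = 0])
  case (step1 n)
  then show ?case using periodic[of "t + of_int n"] by (simp add: add_ac)
next
  case (step2 n)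
  then show ?case using periodic[of "t + of_int (n - 1)"] by simp
qed simp

lemma range_eq: "range \<gamma> = \<gamma> ` {0..1}"
proof -
  have "\<gamma> t \<in> \<gamma> ` {0..1}" for t
  proof
    show "\<gamma> t = \<gamma> (frac t)"
      using periodic_int[of "frac t" "\<lfloor>t\<rfloor>"] by (simp add: frac_def)
    show "frac t \<in> {0..1}" by (simp add: less_imp_le[OF frac_lt_1])
  qed
  then show ?thesis by auto
qed

text \<open>The value of a function at \<open>\<gamma> t\<close>, and the velocity in the coordinate used by germs at \<open>\<gamma> t\<close>.
  The value is meaningful for a function without pole on the curve.\<close>

definition at_curve :: "mfun \<Rightarrow> real \<Rightarrow> complex" where
  "at_curve \<phi> t = fun_germ (\<gamma> t) \<phi> (germ_pt (\<gamma> t))"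

definition velocity :: "real \<Rightarrow> complex" where
  "velocity t = (if \<gamma> t = Infty then vel1 t else vel0 t)"

lemma pullback_germ: "pullback \<gamma> \<alpha> t = form_germ (\<gamma> t) \<alpha> (germ_pt (\<gamma> t)) * velocity t"
  by (cases "\<gamma> t") (simp_all add: pullback_def velocity_def coord0_def)

lemma pullback_add:
  assumes "form_regular_on (range \<gamma>) \<alpha>" "form_regular_on (range \<gamma>) \<beta>"
  shows "pullback \<gamma> (\<alpha> + \<beta>) t = pullback \<gamma> \<alpha> t + pullback \<gamma> \<beta> t"
proof -
  have "\<forall>\<^sub>F w in nhds (germ_pt (\<gamma> t)). form_germ (\<gamma> t) (\<alpha> + \<beta>) w = form_germ (\<gamma> t) \<alpha> w + form_germ (\<gamma> t) \<beta> w"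
    using assms form_regular_on_add[OF assms]
    by (intro analytic_eq_nhds form_germ_add analytic_intros) (auto simp: form_regular_on_iff)
  from eventually_nhds_x_imp_x[OF this] show ?thesis
    by (simp add: pullback_germ distrib_right)
qed

lemma pullback_scale:
  assumes "form_regular_on (range \<gamma>) \<alpha>"
  shows "pullback \<gamma> (mform_scale c \<alpha>) t = c * pullback \<gamma> \<alpha> t"
proof -
  have "\<forall>\<^sub>F w in nhds (germ_pt (\<gamma> t)). form_germ (\<gamma> t) (mform_scale c \<alpha>) w = c * form_germ (\<gamma> t) \<alpha> w"
    using assms form_regular_on_scale[OF assms]
    by (intro analytic_eq_nhds form_germ_scale analytic_intros) (auto simp: form_regular_on_iff)
  from eventually_nhds_x_imp_x[OF this] show ?thesis
    by (simp add: pullback_germ)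
qed

lemma pullback_times:
  assumes "fun_regular_on (range \<gamma>) \<phi>" "form_regular_on (range \<gamma>) \<alpha>"
  shows "pullback \<gamma> (\<phi> \<cdot> \<alpha>) t = at_curve \<phi> t * pullback \<gamma> \<alpha> t"
proof -
  have "\<forall>\<^sub>F w in nhds (germ_pt (\<gamma> t)). form_germ (\<gamma> t) (\<phi> \<cdot> \<alpha>) w = fun_germ (\<gamma> t) \<phi> w * form_germ (\<gamma> t) \<alpha> w"
    using assms form_regular_on_times[OF assms]
    by (intro analytic_eq_nhds form_germ_times analytic_intros)
      (auto simp: form_regular_on_iff fun_regular_on_iff)
  from eventually_nhds_x_imp_x[OF this] show ?thesis
    by (simp add: pullback_germ at_curve_def)
qed

lemma at_curve_derivative:
  assumes "fun_regular_on (range \<gamma>) \<phi>"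
  shows "(at_curve \<phi> has_vector_derivative pullback \<gamma> (differential \<phi>) t) (at t)"
proof -
  have ana: "fun_germ (\<gamma> t) \<phi> analytic_on {germ_pt (\<gamma> t)}" for t
    using assms by (auto simp: fun_regular_on_iff)
  have "\<forall>\<^sub>F w in nhds (germ_pt (\<gamma> t)). form_germ (\<gamma> t) (differential \<phi>) w = deriv (fun_germ (\<gamma> t) \<phi>) w"
    using form_regular_on_differential[OF assms]
    by (intro analytic_eq_nhds form_germ_differential analytic_deriv ana)
      (auto simp: form_regular_on_iff)
  from eventually_nhds_x_imp_x[OF this]
  have pb: "pullback \<gamma> (differential \<phi>) t = velocity t * deriv (fun_germ (\<gamma> t) \<phi>) (germ_pt (\<gamma> t))"
    by (simp add: pullback_germ)
  have fd: "(fun_germ (\<gamma> t) \<phi> has_field_derivative deriv (fun_germ (\<gamma> t) \<phi>) (germ_pt (\<gamma> t))) (at (germ_pt (\<gamma> t)))"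
    using ana[of t] by (simp add: analytic_on_imp_differentiable_at DERIV_deriv_iff_field_differentiable)
  show ?thesis
  proof (cases "\<gamma> t")
    case (Fin x)
    then have "((mf_val \<phi> \<circ> pos0) has_vector_derivative vel0 t * deriv (mf_val \<phi>) (pos0 t)) (at t)"
      using fd by (intro field_vector_diff_chain_at coord_derivative) (simp_all add: coord0_def)
    moreover have "pullback \<gamma> (differential \<phi>) t = vel0 t * deriv (mf_val \<phi>) (pos0 t)"
      by (simp add: pb Fin velocity_def coord0_def)
    ultimately have "((mf_val \<phi> \<circ> pos0) has_vector_derivative pullback \<gamma> (differential \<phi>) t) (at t)"
      by simp
    then show ?thesis
    proof (rule has_vector_derivative_transform_within_open[OF _ open_finite])
      show "(mf_val \<phi> \<circ> pos0) s = at_curve \<phi> s" if "s \<in> {t. \<gamma> t \<noteq> Infty}" for s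
        using that by (cases "\<gamma> s") (simp_all add: at_curve_def coord0_def)
    qed (simp add: Fin)
  next
    case Infty
    then have "((fun_germ Infty \<phi> \<circ> pos1) has_vector_derivative vel1 t * deriv (fun_germ Infty \<phi>) (pos1 t)) (at t)"
      using fd by (intro field_vector_diff_chain_at coord_derivative) (simp_all add: coord_inf_def)
    moreover have "pullback \<gamma> (differential \<phi>) t = vel1 t * deriv (fun_germ Infty \<phi>) (pos1 t)"
      by (simp add: pb Infty velocity_def coord_inf_def)
    ultimately have "((fun_germ Infty \<phi> \<circ> pos1) has_vector_derivative pullback \<gamma> (differential \<phi>) t) (at t)"
      by simp
    then show ?thesis
    proof (rule has_vector_derivative_transform_within_open[OF _ open_nonzero])
      show "(fun_germ Infty \<phi> \<circ> pos1) s = at_curve \<phi> s" if "s \<in> {t. \<gamma> t \<noteq> Fin 0}" for s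
      proof (cases "\<gamma> s")
        case (Fin x)
        with that have x: "x \<noteq> 0" by simp
        have "mf_val \<phi> analytic_on {x}" using ana[of s] Fin by simp
        moreover have "(\<lambda>w. 1 / w) analytic_on {1 / x}"
          using x by (auto intro!: analytic_intros)
        ultimately have "(mf_val \<phi> \<circ> (\<lambda>w. 1 / w)) analytic_on {1 / x}"
          using x by (intro analytic_on_compose_gen[where T = "{x}"]) auto
        then show ?thesis
          using Fin x by (simp add: o_def at_curve_def coord_inf_def)
      qed (simp add: at_curve_def coord_inf_def)
    qed (simp add: Infty)
  qed
qed

text \<open>Since the loop is closed, the integral of \<open>d(\<phi> \<psi>)\<close> over it is zero.\<close>

lemma integral_by_parts:
  assumes "fun_regular_on (range \<gamma>) \<phi>" "fun_regular_on (range \<gamma>) \<psi>"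
  shows "(pullback \<gamma> (\<phi> \<cdot> differential \<psi> + \<psi> \<cdot> differential \<phi>) has_integral 0) {0..1}"
proof -
  let ?H = "\<lambda>t. at_curve \<phi> t * at_curve \<psi> t"
  have "(?H has_vector_derivative pullback \<gamma> (\<phi> \<cdot> differential \<psi> + \<psi> \<cdot> differential \<phi>) t) (at t)" for t
  proof -
    have "(?H has_vector_derivative
        at_curve \<phi> t * pullback \<gamma> (differential \<psi>) t + pullback \<gamma> (differential \<phi>) t * at_curve \<psi> t) (at t)"
      by (intro has_vector_derivative_mult at_curve_derivative assms)
    then show ?thesis
      using assms by (simp add: pullback_add pullback_times form_regular_on_times
          form_regular_on_differential mult.commute)
  qed
  then have "(pullback \<gamma> (\<phi> \<cdot> differential \<psi> + \<psi> \<cdot> differential \<phi>) has_integral ?H 1 - ?H 0) {0..1}"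
    by (intro fundamental_theorem_of_calculus) (auto intro: has_vector_derivative_at_within)
  moreover have "\<gamma> 1 = \<gamma> 0" using periodic[of 0] by simp
  ultimately show ?thesis by (simp add: at_curve_def)
qed

end

locale charted_loop = smooth_loop +
  fixes a :: complex
  assumes a: "Fin a \<notin> range \<gamma>"
begin

text \<open>The loop in the coordinate \<open>u = 1 / (z - a)\<close>; it is a smooth simple closed curve in the plane.\<close>

definition c :: "real \<Rightarrow> complex" where
  "c t = coord_at a (\<gamma> t)"

lemma neq_a: "\<gamma> t \<noteq> Fin a"
  using a by (metis rangeI)

lemma chart_c [simp]: "chart_at a (c t) = \<gamma> t"
  by (simp add: c_def chart_at_coord_at neq_a)

lemma c_derivative_finite:
  assumes "\<gamma> t \<noteq> Infty"
  shows "pos0 t \<noteq> a" "(c has_vector_derivative - vel0 t / (pos0 t - a)\<^sup>2) (at t)"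
proof -
  have ne: "pos0 s \<noteq> a" if "\<gamma> s \<noteq> Infty" for s
    using that neq_a[of s] by (cases "\<gamma> s") (auto simp: coord0_def)
  then show "pos0 t \<noteq> a" using assms by simp
  then have "((\<lambda>x. 1 / (x - a)) has_field_derivative - 1 / (pos0 t - a)\<^sup>2) (at (pos0 t))"
    by (auto intro!: derivative_eq_intros simp: power2_eq_square)
  then have "(((\<lambda>x. 1 / (x - a)) \<circ> pos0) has_vector_derivative vel0 t * (- 1 / (pos0 t - a)\<^sup>2)) (at t)"
    by (rule field_vector_diff_chain_at[OF coord_derivative(1)[OF assms]])
  then have "(((\<lambda>x. 1 / (x - a)) \<circ> pos0) has_vector_derivative - vel0 t / (pos0 t - a)\<^sup>2) (at t)"
    by simp
  then show "(c has_vector_derivative - vel0 t / (pos0 t - a)\<^sup>2) (at t)"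
  proof (rule has_vector_derivative_transform_within_open[OF _ open_finite])
    show "((\<lambda>x. 1 / (x - a)) \<circ> pos0) s = c s" if "s \<in> {t. \<gamma> t \<noteq> Infty}" for s
      using that by (cases "\<gamma> s") (simp_all add: c_def coord_at_def coord0_def)
  qed (use assms in simp)
qed

lemma c_derivative_nonzero:
  assumes "\<gamma> t \<noteq> Fin 0"
  shows "1 - a * pos1 t \<noteq> 0" "(c has_vector_derivative vel1 t / (1 - a * pos1 t)\<^sup>2) (at t)"
proof -
  have *: "1 - a * pos1 s \<noteq> 0 \<and> c s = pos1 s / (1 - a * pos1 s)" if "\<gamma> s \<noteq> Fin 0" for s
  proof -
    have "\<gamma> s = chart_inf (pos1 s)"
      using that by (cases "\<gamma> s") (auto simp: chart_inf_def coord_inf_def)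
    then show ?thesis
      using neq_a[of s] by (metis c_def chart_inf_neq_iff coord_at_chart_inf)
  qed
  then show ne: "1 - a * pos1 t \<noteq> 0" using assms by simp
  have "((\<lambda>x. x / (1 - a * x)) has_field_derivative 1 / (1 - a * pos1 t)\<^sup>2) (at (pos1 t))"
    using ne by (auto intro!: derivative_eq_intros simp: power2_eq_square field_simps)
  then have "(((\<lambda>x. x / (1 - a * x)) \<circ> pos1) has_vector_derivative vel1 t * (1 / (1 - a * pos1 t)\<^sup>2)) (at t)"
    by (rule field_vector_diff_chain_at[OF coord_derivative(2)[OF assms]])
  then have "(((\<lambda>x. x / (1 - a * x)) \<circ> pos1) has_vector_derivative vel1 t / (1 - a * pos1 t)\<^sup>2) (at t)"
    by simp
  then show "(c has_vector_derivative vel1 t / (1 - a * pos1 t)\<^sup>2) (at t)"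
    by (rule has_vector_derivative_transform_within_open[OF _ open_nonzero]) (use assms * in simp_all)
qed

lemma c_derivative: "(c has_vector_derivative vector_derivative c (at t)) (at t)"
  using c_derivative_finite(2)[of t] c_derivative_nonzero(2)[of t]
  by (cases "\<gamma> t = Infty") (auto simp: vector_derivative_at)

lemma c_derivative_continuous: "continuous_on UNIV (\<lambda>t. vector_derivative c (at t))"
proof -
  have "continuous_on {t. \<gamma> t \<noteq> Infty} (\<lambda>t. - vel0 t / (pos0 t - a)\<^sup>2)"
    by (intro continuous_intros coord_derivative coord_continuous) (use c_derivative_finite(1) in auto)
  then have 1: "continuous_on {t. \<gamma> t \<noteq> Infty} (\<lambda>t. vector_derivative c (at t))"
    by (rule continuous_on_eq) (simp add: vector_derivative_at[OF c_derivative_finite(2)])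
  have "continuous_on {t. \<gamma> t \<noteq> Fin 0} (\<lambda>t. vel1 t / (1 - a * pos1 t)\<^sup>2)"
    by (intro continuous_intros coord_derivative coord_continuous) (use c_derivative_nonzero(1) in auto)
  then have 2: "continuous_on {t. \<gamma> t \<noteq> Fin 0} (\<lambda>t. vector_derivative c (at t))"
    by (rule continuous_on_eq) (simp add: vector_derivative_at[OF c_derivative_nonzero(2)])
  have "{t. \<gamma> t \<noteq> Infty} \<union> {t. \<gamma> t \<noteq> Fin 0} = UNIV" by auto
  then show ?thesis
    using continuous_on_open_Un[OF open_finite open_nonzero 1 2] by simp
qed

lemma valid_path_c: "valid_path c"
proof -
  have "c C1_differentiable_on {0..1}"
    unfolding C1_differentiable_on_def
    by (rule exI[of _ "\<lambda>t. vector_derivative c (at t)"])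
      (intro conjI ballI c_derivative continuous_on_subset[OF c_derivative_continuous] subset_UNIV)
  then show ?thesis
    by (simp add: valid_path_def C1_differentiable_imp_piecewise)
qed

lemma path_image_c: "path_image c = coord_at a ` range \<gamma>"
  unfolding path_image_def range_eq by (auto simp: c_def)

lemma in_path_image_c_iff: "u \<in> path_image c \<longleftrightarrow> chart_at a u \<in> range \<gamma>"
proof
  assume "u \<in> path_image c"
  then obtain t where "u = c t" by (auto simp: path_image_def)
  then show "chart_at a u \<in> range \<gamma>" by simp
next
  assume "chart_at a u \<in> range \<gamma>"
  then obtain t where "\<gamma> t = chart_at a u" by auto
  then have "c t = u" by (simp add: c_def)
  then show "u \<in> path_image c" unfolding path_image_c c_def by blast
qed

lemma closed_c: "pathfinish c = pathstart c"
  using periodic[of 0] by (simp add: pathfinish_def pathstart_def c_def)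

lemma simple_path_c: "simple_path c"
proof -
  have "s = t \<or> s = 0 \<and> t = 1 \<or> s = 1 \<and> t = 0"
    if range: "s \<in> {0..1}" "t \<in> {0..1}" and eq: "c s = c t" for s t
  proof -
    have st: "\<gamma> s = \<gamma> t" using eq by (metis chart_c)
    have 1: "\<gamma> 1 = \<gamma> 0" using periodic[of 0] by simp
    consider "s < 1" "t < 1" | "s = 1" "t = 1" | "s = 1" "t < 1" | "s < 1" "t = 1"
      using range by fastforce
    then show ?thesis
      using range st 1 inj by cases (auto dest: inj_onD)
  qed
  then show ?thesis
    using valid_path_imp_path[OF valid_path_c] by (auto simp: simple_path_def loop_free_def)
qed

lemma pullback_chart: "pullback \<gamma> \<alpha> t = chart_form a \<alpha> (c t) * vector_derivative c (at t)"
proof (cases "\<gamma> t")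
  case (Fin x)
  then have t: "\<gamma> t \<noteq> Infty" by simp
  have x: "pos0 t = x" "c t = 1 / (x - a)" using Fin by (simp_all add: coord0_def c_def coord_at_def)
  have "x - a \<noteq> 0" using c_derivative_finite(1)[OF t] x by simp
  then have "chart_form a \<alpha> (c t) = - coeff \<alpha> x * (x - a)\<^sup>2"
    by (simp add: chart_form_def x(2) power_divide)
  moreover have "vector_derivative c (at t) = - vel0 t / (x - a)\<^sup>2"
    using vector_derivative_at[OF c_derivative_finite(2)[OF t]] by (simp only: x(1))
  moreover have "pullback \<gamma> \<alpha> t = coeff \<alpha> x * vel0 t"
    unfolding pullback_def using t by (simp only: x(1) if_False)
  ultimately show ?thesis
    using \<open>x - a \<noteq> 0\<close> by simp
next
  case Infty
  then have t: "\<gamma> t \<noteq> Fin 0" by simp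
  have "pos1 t = 0" "c t = 0" using Infty by (simp_all add: coord_inf_def c_def coord_at_def)
  then show ?thesis
    using Infty by (simp add: vector_derivative_at[OF c_derivative_nonzero(2)[OF t]] chart_form_def
        pullback_def)
qed

lemma has_integral_pullback_iff:
  "(pullback \<gamma> \<alpha> has_integral i) {0..1} \<longleftrightarrow> (chart_form a \<alpha> has_contour_integral i) c"
  unfolding has_contour_integral pullback_chart[abs_def] ..

lemma open_analytic_set: "open {u. f analytic_on {u}}" for f :: "complex \<Rightarrow> complex"
proof (subst open_subopen, intro ballI)
  fix u assume "u \<in> {u. f analytic_on {u}}"
  then obtain T where "open T" "u \<in> T" "f holomorphic_on T" by (auto simp: analytic_at)
  then show "\<exists>T. open T \<and> u \<in> T \<and> T \<subseteq> {u. f analytic_on {u}}"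
    using holomorphic_on_imp_analytic_at by blast
qed

lemma holomorphic_analytic_set: "f holomorphic_on {u. f analytic_on {u}}" for f :: "complex \<Rightarrow> complex"
  by (rule analytic_imp_holomorphic, subst analytic_on_analytic_at) simp

lemma path_image_analytic:
  assumes "form_regular_on (range \<gamma>) \<alpha>"
  shows "path_image c \<subseteq> {u. chart_form a \<alpha> analytic_on {u}}"
  by (auto simp: in_path_image_c_iff intro!: chart_form_analytic form_regular_on_subset[OF assms])

lemma pullback_integrable:
  assumes "form_regular_on (range \<gamma>) \<alpha>"
  shows "pullback \<gamma> \<alpha> integrable_on {0..1}"
proof -
  have "chart_form a \<alpha> contour_integrable_on c"
    by (rule contour_integrable_holomorphic_simple[OF holomorphic_analytic_set open_analytic_set
          valid_path_c path_image_analytic[OF assms]])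
  then show ?thesis
    by (auto simp: contour_integrable_on_def integrable_on_def has_integral_pullback_iff)
qed

end

context charted_loop
begin

text \<open>Cauchy's theorem on the projective line: the integral of a form regular on \<open>U\<close> and on the loop is
  zero if \<open>U\<close> and \<open>V\<close> are disjoint nonempty open sets with union the complement of the loop.  In the
  chart in which the point \<open>a\<close> of \<open>V\<close> is at infinity, the outside of the loop meets \<open>V\<close>, hence lies in
  \<open>V\<close>.  The inside then lies in \<open>U\<close>, as \<open>U\<close> is nonempty.  So the form can fail to be analytic only
  outside the loop.\<close>

lemma Cauchy_loop:
  assumes "open U" "open V" "U \<inter> V = {}" "U \<union> V = - range \<gamma>" "U \<noteq> {}" "Fin a \<in> V"
    and \<alpha>: "form_regular_on (U \<union> range \<gamma>) \<alpha>"
  shows "(pullback \<gamma> \<alpha> has_integral 0) {0..1}"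
  unfolding has_integral_pullback_iff
proof (rule Cauchy_theorem_global[OF open_analytic_set holomorphic_analytic_set valid_path_c closed_c])
  show "path_image c \<subseteq> {u. chart_form a \<alpha> analytic_on {u}}"
    by (rule path_image_analytic[OF form_regular_on_subset[OF \<alpha>]]) auto
  define U' where "U' = chart_at a -` U"
  define V' where "V' = chart_at a -` V"
  define ins where "ins = inside (path_image c)"
  define outs where "outs = outside (path_image c)"
  note Jordan = Jordan_inside_outside[OF simple_path_c closed_c, folded ins_def outs_def]
  have opens: "open U'" "open V'"
    unfolding U'_def V'_def using assms(1,2) by (auto intro: open_vimage_chart_at)
  have disj: "U' \<inter> V' = {}"
    using assms(3) by (auto simp: U'_def V'_def)
  have "chart_at a u \<in> U \<union> V \<longleftrightarrow> chart_at a u \<notin> range \<gamma>" for u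
    using assms(4) by simp
  then have cover: "U' \<union> V' = - path_image c"
    unfolding set_eq_iff by (simp add: U'_def V'_def in_path_image_c_iff)
  \<comment> \<open>The inside and the outside of the loop are connected, so each lies in \<open>U'\<close> or in \<open>V'\<close>.\<close>
  have side: "S \<subseteq> V'" if S: "connected S" "S \<subseteq> - path_image c" "S \<inter> V' \<noteq> {}" for S
    using connectedD[OF S(1) opens] disj cover S(2,3) by blast
  have subs: "ins \<subseteq> - path_image c" "outs \<subseteq> - path_image c" "ins \<union> outs = - path_image c"
    using Jordan by auto
  \<comment> \<open>All large \<open>u\<close> are in \<open>V'\<close>, because \<open>V\<close> is a neighbourhood of \<open>a\<close>.\<close>
  have "outs \<inter> V' \<noteq> {}"
  proof -
    have "open (Fin -` V)" "a \<in> Fin -` V"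
      using assms(2,6) by (auto simp: open_proj_line_iff)
    then obtain e where e: "e > 0" "ball a e \<subseteq> Fin -` V"
      by (rule openE)
    have "\<not> outs \<subseteq> cball 0 (1 / e)"
      using Jordan bounded_cball bounded_subset by blast
    then obtain u where u: "u \<in> outs" "norm u > 1 / e"
      by (auto simp: subset_iff not_le)
    with e(1) have "u \<noteq> 0" by (auto simp: zero_less_divide_iff not_less)
    with u(2) e(1) have "norm (1 / u) < e"
      by (simp add: norm_divide field_simps)
    then have "Fin (a + 1 / u) \<in> V"
      using e(2) by (auto simp: dist_norm norm_divide subset_iff)
    with u(1) \<open>u \<noteq> 0\<close> show ?thesis by (auto simp: V'_def chart_at_def)
  qed
  then have outs: "outs \<subseteq> V'"
    using Jordan subs by (intro side) auto
  fix u assume u: "u \<notin> {u. chart_form a \<alpha> analytic_on {u}}"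
  then have "\<not> form_regular_on {chart_at a u} \<alpha>"
    using chart_form_analytic by auto
  then have "chart_at a u \<notin> U \<union> range \<gamma>"
    using \<alpha> form_regular_on_subset by blast
  then have uV: "u \<in> V'" "u \<notin> path_image c"
    using assms(4) by (auto simp: V'_def in_path_image_c_iff)
  have "u \<notin> ins"
  proof
    assume "u \<in> ins"
    with uV have "ins \<subseteq> V'"
      using Jordan subs by (intro side) auto
    with outs subs(3) cover disj have U': "U' = {}" by blast
    obtain P where "P \<in> U" using assms(5) by auto
    moreover from this assms(3,6) have "P \<noteq> Fin a" by auto
    ultimately have "coord_at a P \<in> U'"
      by (simp add: U'_def chart_at_coord_at)
    with U' show False by simp
  qed
  with uV subs(3) have "u \<in> outside (path_image c)"
    by (auto simp: outs_def)
  then show "winding_number c u = 0"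
    using valid_path_c closed_c by (intro winding_number_zero_in_outside valid_path_imp_path)
qed

text \<open>The Jordan curve theorem on the projective line: the inside of the loop, and the outside together
  with the point \<open>a\<close> at infinity, are open, disjoint and cover the complement.\<close>

lemma complement_disconnected: "\<not> connected (- range \<gamma>)"
proof
  assume conn: "connected (- range \<gamma>)"
  define ins where "ins = inside (path_image c)"
  define outs where "outs = outside (path_image c)"
  note Jordan = Jordan_inside_outside[OF simple_path_c closed_c, folded ins_def outs_def]
  obtain B where B: "B > 0" "\<And>u. norm u > B \<Longrightarrow> u \<in> outs"
  proof -
    have "bounded (- outs)"
      unfolding outs_def by (rule cobounded_outside[OF bounded_valid_path_image[OF valid_path_c]])
    then obtain B where "B > 0" "- outs \<subseteq> ball 0 B"
      by (meson bounded_subset_ballD)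
    then show ?thesis by (intro that[of B]) (auto simp: subset_iff)
  qed
  define A1 where "A1 = chart_at a ` ins"
  define A2 where "A2 = chart_at a ` outs \<union> Fin ` ball a (1 / B)"
  have "open A1" "open A2"
    unfolding A1_def A2_def using Jordan by (auto intro!: open_image_chart_at open_image_Fin open_Un)
  have near: "P = Fin a \<or> P \<in> chart_at a ` outs" if "P \<in> Fin ` ball a (1 / B)" for P
  proof (cases "P = Fin a")
    case False
    obtain x where x: "P = Fin x" "dist a x < 1 / B" using \<open>P \<in> _\<close> by auto
    with False have "x - a \<noteq> 0" by auto
    with x(2) B(1) have "norm (1 / (x - a)) > B"
      by (simp add: dist_norm norm_minus_commute norm_divide field_simps)
    then have "coord_at a P \<in> outs" using B(2) x(1) by (simp add: coord_at_def)
    with chart_at_coord_at[OF False] show ?thesis by (metis imageI)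
  qed simp
  have A2: "A2 = insert (Fin a) (chart_at a ` outs)"
    unfolding A2_def using near B(1) by auto
  have inj: "chart_at a u = chart_at a v \<Longrightarrow> u = v" for u v
    by (metis coord_at_chart_at)
  have "A1 \<inter> A2 = {}"
    unfolding A1_def A2 using Jordan inj by (auto dest!: inj) (metis chart_at_neq)+
  moreover have "A1 \<union> A2 = - range \<gamma>"
  proof -
    have "P \<in> A1 \<union> A2 \<longleftrightarrow> P \<notin> range \<gamma>" for P
    proof (cases "P = Fin a")
      case True
      then show ?thesis using a by (simp add: A2)
    next
      case False
      have "P \<in> chart_at a ` S \<longleftrightarrow> coord_at a P \<in> S" for S
        using chart_at_coord_at[OF False] by (metis coord_at_chart_at image_iff)
      then have "P \<in> A1 \<union> A2 \<longleftrightarrow> coord_at a P \<in> ins \<union> outs"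
        using False by (simp add: A1_def A2)
      also have "\<dots> \<longleftrightarrow> coord_at a P \<notin> path_image c"
        using Jordan by auto
      finally show ?thesis
        by (simp add: in_path_image_c_iff chart_at_coord_at[OF False])
    qed
    then show ?thesis by auto
  qed
  moreover have "A1 \<noteq> {}" "A2 \<noteq> {}"
    using Jordan by (auto simp: A1_def A2)
  ultimately show False
    using connectedD[OF conn \<open>open A1\<close> \<open>open A2\<close>] by blast
qed

end

section \<open>The operators attached to a disc\<close>

text \<open>The parametrisation \<open>\<gamma>\<close> below is the one that enters the definition of the boundary integral.\<close>

locale disc =
  fixes D :: "proj_line set"
  assumes disc: "is_disc D"
begin

definition \<gamma> :: "real \<Rightarrow> proj_line" where
  "\<gamma> = (SOME \<gamma>. boundary_param D \<gamma>)"

lemma boundary_param: "boundary_param D \<gamma>"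
  unfolding \<gamma>_def using disc by (metis is_disc_def someI_ex)

lemma range_\<gamma>: "range \<gamma> = frontier D"
  using boundary_param by (simp add: boundary_param_def)

sublocale smooth_loop \<gamma>
  using boundary_param by unfold_locales (simp_all add: boundary_param_def)

lemma boundary_integral_eq: "boundary_integral D \<alpha> = integral {0..1} (pullback \<gamma> \<alpha>)"
  by (simp add: boundary_integral_def \<gamma>_def)

lemma open_D: "open D" and connected_D: "connected D"
  using disc by (simp_all add: is_disc_def)

lemma D_nonempty: "D \<noteq> {}"
  using disc by (auto simp: is_disc_def biholomorphic_to_disc_def)

lemma complement: "D \<union> exterior D = - range \<gamma>" "D \<inter> exterior D = {}" "open (exterior D)"
proof -
  show "D \<union> exterior D = - range \<gamma>"
    using open_D closure_subset[of D]
    by (auto simp: range_\<gamma> frontier_def exterior_def interior_open)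
  show "D \<inter> exterior D = {}"
    using closure_subset[of D] by (auto simp: exterior_def)
  show "open (exterior D)"
    by (simp add: exterior_def open_Compl)
qed

lemma charted: "Fin a \<in> D \<union> exterior D \<Longrightarrow> charted_loop \<gamma> a"
  by unfold_locales (use complement(1) in auto)

text \<open>Otherwise the connected set \<open>D\<close> would be the complement of its boundary curve.\<close>

lemma exterior_nonempty: "exterior D \<noteq> {}"
proof
  assume "exterior D = {}"
  then have "connected (- range \<gamma>)"
    using complement(1) connected_D by simp
  moreover obtain a where "Fin a \<in> D"
    using open_nonempty_Fin[OF open_D D_nonempty] .
  then have "charted_loop \<gamma> a" by (intro charted) simp
  ultimately show False
    using charted_loop.complement_disconnected by blast
qed

lemma integrable:
  assumes "form_regular_on (frontier D) \<alpha>"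
  shows "pullback \<gamma> \<alpha> integrable_on {0..1}"
proof -
  obtain a where "Fin a \<in> D"
    using open_nonempty_Fin[OF open_D D_nonempty] .
  then have "charted_loop \<gamma> a" by (intro charted) simp
  then show ?thesis
    using assms charted_loop.pullback_integrable by (metis range_\<gamma>)
qed

lemma boundary_integral_add:
  assumes "form_regular_on (frontier D) \<alpha>" "form_regular_on (frontier D) \<beta>"
  shows "boundary_integral D (\<alpha> + \<beta>) = boundary_integral D \<alpha> + boundary_integral D \<beta>"
proof -
  have "pullback \<gamma> (\<alpha> + \<beta>) = (\<lambda>t. pullback \<gamma> \<alpha> t + pullback \<gamma> \<beta> t)"
    using assms by (auto simp: pullback_add range_\<gamma>)
  then show ?thesis
    by (simp add: boundary_integral_eq integral_add integrable assms)
qed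

lemma boundary_integral_scale:
  assumes "form_regular_on (frontier D) \<alpha>"
  shows "boundary_integral D (mform_scale c \<alpha>) = c * boundary_integral D \<alpha>"
proof -
  have "pullback \<gamma> (mform_scale c \<alpha>) = (\<lambda>t. c * pullback \<gamma> \<alpha> t)"
    using assms by (auto simp: pullback_scale range_\<gamma>)
  then show ?thesis
    by (simp add: boundary_integral_eq)
qed

lemma boundary_integral_by_parts:
  assumes "fun_regular_on (frontier D) \<phi>" "fun_regular_on (frontier D) \<psi>"
  shows "boundary_integral D (\<phi> \<cdot> differential \<psi>) = - boundary_integral D (\<psi> \<cdot> differential \<phi>)"
proof -
  have "boundary_integral D (\<phi> \<cdot> differential \<psi> + \<psi> \<cdot> differential \<phi>) = 0"
    unfolding boundary_integral_eq
    by (rule integral_unique, rule integral_by_parts) (simp_all add: range_\<gamma> assms)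
  then show ?thesis
    using assms by (simp add: boundary_integral_add form_regular_on_times
        form_regular_on_differential eq_neg_iff_add_eq_0)
qed

lemma boundary_integral_regular:
  assumes "form_regular_on (S \<union> frontier D) \<alpha>" "S = D \<or> S = exterior D"
  shows "boundary_integral D \<alpha> = 0"
proof -
  obtain V where V: "open V" "V \<noteq> {}" "S \<inter> V = {}" "S \<union> V = - range \<gamma>" "open S" "S \<noteq> {}"
      "V \<subseteq> D \<union> exterior D"
    using assms(2)
  proof
    assume "S = D"
    then show ?thesis
      using complement exterior_nonempty D_nonempty open_D by (intro that[of "exterior D"]) auto
  next
    assume "S = exterior D"
    then show ?thesis
      using complement exterior_nonempty D_nonempty open_D by (intro that[of D]) auto
  qed
  obtain a where aV: "Fin a \<in> V"
    using open_nonempty_Fin[OF V(1,2)] .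
  then interpret charted_loop \<gamma> a
    using V(7) by (intro charted) auto
  have "(pullback \<gamma> \<alpha> has_integral 0) {0..1}"
    using assms(1) V aV by (intro Cauchy_loop[of S V]) (simp_all add: range_\<gamma>)
  then show ?thesis
    by (simp add: boundary_integral_eq integral_unique)
qed

lemma subspace_K_bd: "mform.subspace (K_bd D)"
proof (rule mform.subspaceI)
  have "coeff 0 = (\<lambda>_. 0)" by (rule zero_mform.rep_eq)
  moreover have "remove_sings (\<lambda>w. 0) = (\<lambda>_. 0)" by (rule ext) simp
  ultimately have "form_regular_on S 0" for S
    by (auto simp: form_regular_on_def coeff_inf_def split: proj_line.split)
  then show "0 \<in> K_bd D"
    using mform.subspace_0[OF subspace_K_space] by (simp add: K_bd_def)
qed (simp_all add: K_bd_def mform.subspace_add[OF subspace_K_space]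
    mform.subspace_scale[OF subspace_K_space] form_regular_on_add form_regular_on_scale)

sublocale residue_functional "K_bd D" "{\<alpha>. form_regular_on (frontier D) \<alpha>}"
  "{\<phi>. fun_regular_on (frontier D) \<phi>}"
  "\<lambda>\<alpha>. - (1 / (2 * of_real pi * \<i>) * boundary_integral D \<alpha>)"
proof
  show "- (1 / (2 * of_real pi * \<i>) * boundary_integral D (\<phi> \<cdot> differential \<psi>))
      = - (- (1 / (2 * of_real pi * \<i>) * boundary_integral D (\<psi> \<cdot> differential \<phi>)))"
    if "\<phi> \<in> {\<phi>. fun_regular_on (frontier D) \<phi>}" "\<psi> \<in> {\<phi>. fun_regular_on (frontier D) \<phi>}" for \<phi> \<psi>
    using that by (simp add: boundary_integral_by_parts[of \<phi> \<psi>])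
  show "mform.subspace (K_bd D)" by (rule subspace_K_bd)
qed (auto simp: K_bd_def fun_regular_on_add differential_in_K_space
    form_regular_on_differential form_regular_on_times boundary_integral_add boundary_integral_scale
    algebra_simps add_divide_distrib)

lemma Phi_disc_commutator:
  assumes "fun_regular_on (frontier D) \<phi>" "fun_regular_on (frontier D) \<psi>" "w \<in> carrier (W_bd D)"
  shows "Phi_disc D \<phi> (Phi_disc D \<psi> w) \<ominus>\<^bsub>W_bd D\<^esub> Phi_disc D \<psi> (Phi_disc D \<phi> w)
    = sym_scale (K_bd D) (- (1 / (2 * pi * \<i>) * boundary_integral D (\<phi> \<cdot> differential \<psi>))) w"
proof -
  let ?L = "\<lambda>\<alpha>. - (1 / (2 * of_real pi * \<i>) * boundary_integral D \<alpha>)"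
  let ?S = "exterior D \<union> frontier D" and ?T = "D \<union> frontier D"
  have "?S \<inter> ?T = frontier D"
    using complement(2) by auto
  with assms have ST: "fun_regular_on (?S \<inter> ?T) \<phi>" "fun_regular_on (?S \<inter> ?T) \<psi>"
    by simp_all
  obtain \<phi>1 \<phi>2 where \<phi>: "split_fun ?S ?T \<phi> = (\<phi>1, \<phi>2)" "\<phi> = \<phi>1 + \<phi>2"
    "fun_regular_on ?S \<phi>1" "fun_regular_on ?T \<phi>2"
    by (rule split_fun_props[OF ST(1)])
  obtain \<psi>1 \<psi>2 where \<psi>: "split_fun ?S ?T \<psi> = (\<psi>1, \<psi>2)" "\<psi> = \<psi>1 + \<psi>2"
    "fun_regular_on ?S \<psi>1" "fun_regular_on ?T \<psi>2"
    by (rule split_fun_props[OF ST(2)])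
  have op: "Phi_disc D \<eta> = field_op (K_bd D) ?L \<eta>1 \<eta>2"
    if "split_fun ?S ?T \<eta> = (\<eta>1, \<eta>2)" for \<eta> \<eta>1 \<eta>2
    by (rule ext) (simp add: Phi_disc_def field_op_def that Let_def)
  have null: "?L (\<phi>1 \<cdot> differential \<psi>1) = 0" "?L (\<phi>2 \<cdot> differential \<psi>2) = 0"
    using boundary_integral_regular[OF form_regular_on_times[OF \<phi>(3) form_regular_on_differential[OF \<psi>(3)]]]
      boundary_integral_regular[OF form_regular_on_times[OF \<phi>(4) form_regular_on_differential[OF \<psi>(4)]]]
    by simp_all
  have reg: "\<phi>1 \<in> {\<phi>. fun_regular_on (frontier D) \<phi>}" "\<phi>2 \<in> {\<phi>. fun_regular_on (frontier D) \<phi>}"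
    "\<psi>1 \<in> {\<phi>. fun_regular_on (frontier D) \<phi>}" "\<psi>2 \<in> {\<phi>. fun_regular_on (frontier D) \<phi>}"
    using \<phi>(3,4) \<psi>(3,4) by (auto intro: fun_regular_on_subset)
  from field_op_commutator[OF reg null, of w] assms(3) show ?thesis
    unfolding op[OF \<phi>(1)] op[OF \<psi>(1)] W_bd_def \<phi>(2)[symmetric] \<psi>(2)[symmetric] by simp
qed

end

theorem proposition5p9:
  fixes \<phi> \<psi> :: mfun
  shows
    "(\<forall>D. is_disc D \<and> fun_regular_on (frontier D) \<phi> \<and> fun_regular_on (frontier D) \<psi> \<longrightarrow>
        (\<forall>w\<in>carrier (W_bd D).
           Phi_disc D \<phi> (Phi_disc D \<psi> w) \<ominus>\<^bsub>W_bd D\<^esub> Phi_disc D \<psi> (Phi_disc D \<phi> w)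
             = sym_scale (K_bd D)
                 (- (1 / (2 * pi * \<i>) * boundary_integral D (\<phi> \<cdot> differential \<psi>))) w))
     \<and> (\<forall>P. \<forall>w\<in>carrier W.
           Phi_right P \<phi> (Phi_right P \<psi> w) \<ominus>\<^bsub>W\<^esub> Phi_right P \<psi> (Phi_right P \<phi> w)
             = sym_scale K_space (Res P (\<phi> \<cdot> differential \<psi>)) w)
     \<and> (\<forall>Q. \<forall>w\<in>carrier W.
           Phi_left Q \<phi> (Phi_left Q \<psi> w) \<ominus>\<^bsub>W\<^esub> Phi_left Q \<psi> (Phi_left Q \<phi> w)
             = sym_scale K_space (- Res Q (\<phi> \<cdot> differential \<psi>)) w)"
  using disc.Phi_disc_commutator[OF disc.intro] Phi_right_commutator Phi_left_commutator
  by blast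

end
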